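(* Let $n\ge2$ and $n\neq 2k$, and let $(\mathbb{R}^n,\delta_{ij}\varphi^{-2})$ be a steady gradient $k$-Yamabe soliton with $f$ as potential function, where $\delta=\sum_{i=1}^n\varepsilon_i\,dx_i\otimes dx_i$, $\varepsilon_i=\pm1$, is the pseudo-Euclidean metric. Then $\varphi$ and $f$ are invariant under an $(n-1)$-dimensional translation group whose basic invariant is $\xi=\sum\alpha_ix_i$ and $\alpha=\sum_{i=1}^n\alpha_i\frac{\partial}{\partial x_i}$ is a space-like or time-like vector if, and only if, $\varphi$ and $f$ verify: (a) In the case $\varphi'=0$, $$\varphi(\xi)=b,\qquad f(\xi)=c\,\xi+d,\qquad c,d\in\mathbb{R},\quad b\in(0,\infty).$$ (b) In the case $\varphi'\neq0$, $$f(\xi)=\int\frac{c}{\varphi^2(\xi)}\,d\xi+d,\qquad c,d\in\mathbb{R},$$ and $$\int\frac{d\varphi}{\varphi^{\frac n{2k}}\left[\frac{(n-2k)p(1-2k)}{2nk-n+2k}\,\varphi^{\frac{2-n}{2}\frac{2nk-n+2k}{n-2k}}+c_1\right]^{\frac1{2k-1}}}=\frac{2k}{2k-n}\,\xi+c_2,\qquad c_1,c_2\in\mathbb{R},$$ where $$p=\frac{c}{2(n-1)k\,b_{n,k}}\left(\frac{2k-n}{2k}\right)^{2(k-1)},\qquad b_{n,k}=\frac{(n-1)!}{k!(n-k)!}(-1)^{k-1}\frac1{2^{k-1}}.$$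
   Context: A pseudo-Riemannian manifold $(M^n,g)$ is a gradient $k$-Yamabe soliton ($1\le k\le n$) if there are a constant $\lambda\in\mathbb{R}$ (the soliton constant) and a function $f\in C^\infty(M)$ (the potential function) with $\nabla^2 f=2(n-1)(\sigma_k-\lambda)g$, where $\nabla^2 f$ is the Hessian of $f$ with respect to $g$ and $\sigma_k$ is the $k$-th elementary symmetric function of the eigenvalues of $g^{-1}A_g$. Here $A_g=\frac1{n-2}\left[Ric_g-\frac{scal_g}{2(n-1)}g\right]$ is the Schouten tensor; for a conformal metric $g=\delta/\varphi^2$ it is computed as $A_g=\frac{\nabla^2_\delta\varphi}{\varphi}-\frac{|\nabla_\delta\varphi|^2}{2\varphi^2}\delta$. The soliton is steady if $\lambda=0$. The conformal factor $\varphi$ is a positive smooth function. Invariance under the translation group with basic invariant $\xi$ means that $\varphi=\varphi(\xi)$ and $f=f(\xi)$ are functions of $\xi$ only; primes denote derivatives with respect to $\xi$. The vector $\alpha$ is space-like or time-like when $\|\alpha\|^2=\sum_i\varepsilon_i\alpha_i^2\neq0$. The integrals are antiderivatives, so the second formula in (b) determines $\varphi$ implicitly as a function of $\xi$. *)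

theory Defs
  imports "HOL-Analysis.Analysis" "HOL-Computational_Algebra.Polynomial"
begin

section \<open>Smooth functions and pseudo-Riemannian geometry in the global chart of \<open>\<real>\<^sup>n\<close>\<close>

definition partial :: "'n::finite \<Rightarrow> (real ^ 'n \<Rightarrow> real) \<Rightarrow> real ^ 'n \<Rightarrow> real" where
  "partial i h x = frechet_derivative h (at x) (axis i 1)"

fun Ck :: "nat \<Rightarrow> (real ^ 'n::finite \<Rightarrow> real) \<Rightarrow> bool" where
  "Ck 0 h \<longleftrightarrow> continuous_on UNIV h"
| "Ck (Suc m) h \<longleftrightarrow> (\<forall>x. h differentiable (at x)) \<and> (\<forall>i. Ck m (partial i h))"

definition smooth :: "(real ^ 'n::finite \<Rightarrow> real) \<Rightarrow> bool" where
  "smooth h \<longleftrightarrow> (\<forall>m. Ck m h)"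

text \<open>A field of bilinear forms on \<open>\<real>\<^sup>n\<close> is given by its matrix in the standard coordinates.
  No separate constancy of the signature is needed, since \<open>\<real>\<^sup>n\<close> is connected.\<close>

definition pseudo_Riemannian_metric :: "(real ^ 'n::finite \<Rightarrow> real ^ 'n ^ 'n) \<Rightarrow> bool" where
  "pseudo_Riemannian_metric g \<longleftrightarrow>
     (\<forall>i j. smooth (\<lambda>x. g x $ i $ j)) \<and> (\<forall>x. transpose (g x) = g x \<and> invertible (g x))"

text \<open>\<open>christoffel g m i j\<close> is the symbol \<open>\<Gamma>\<close> with upper index \<open>m\<close> and lower indices \<open>i\<close>, \<open>j\<close>.\<close>

definition christoffel ::
  "(real ^ 'n::finite \<Rightarrow> real ^ 'n ^ 'n) \<Rightarrow> 'n \<Rightarrow> 'n \<Rightarrow> 'n \<Rightarrow> real ^ 'n \<Rightarrow> real" where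
  "christoffel g m i j x =
     (\<Sum>l\<in>UNIV. matrix_inv (g x) $ m $ l *
        (partial i (\<lambda>y. g y $ j $ l) x + partial j (\<lambda>y. g y $ i $ l) x
          - partial l (\<lambda>y. g y $ i $ j) x)) / 2"

definition hessian ::
  "(real ^ 'n::finite \<Rightarrow> real ^ 'n ^ 'n) \<Rightarrow> (real ^ 'n \<Rightarrow> real) \<Rightarrow> real ^ 'n \<Rightarrow> real ^ 'n ^ 'n" where
  "hessian g f x =
     (\<chi> i j. partial i (partial j f) x - (\<Sum>m\<in>UNIV. christoffel g m i j x * partial m f x))"

text \<open>Sign convention: the round sphere has positive Ricci tensor.\<close>

definition ricci ::
  "(real ^ 'n::finite \<Rightarrow> real ^ 'n ^ 'n) \<Rightarrow> real ^ 'n \<Rightarrow> real ^ 'n ^ 'n" where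
  "ricci g x =
     (\<chi> i j. (\<Sum>m\<in>UNIV. partial m (christoffel g m i j) x - partial j (christoffel g m i m) x
        + (\<Sum>l\<in>UNIV. christoffel g m m l x * christoffel g l i j x
                   - christoffel g m j l x * christoffel g l i m x)))"

definition scalar_curvature ::
  "(real ^ 'n::finite \<Rightarrow> real ^ 'n ^ 'n) \<Rightarrow> real ^ 'n \<Rightarrow> real" where
  "scalar_curvature g x = (\<Sum>i\<in>UNIV. \<Sum>j\<in>UNIV. matrix_inv (g x) $ i $ j * ricci g x $ i $ j)"

text \<open>Meaningful for dimension at least 3 only, because of the factor \<open>1 / (n - 2)\<close>.\<close>

definition schouten ::
  "(real ^ 'n::finite \<Rightarrow> real ^ 'n ^ 'n) \<Rightarrow> real ^ 'n \<Rightarrow> real ^ 'n ^ 'n" where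
  "schouten g x =
     (1 / (real CARD('n) - 2)) *\<^sub>R
       (ricci g x - (scalar_curvature g x / (2 * (real CARD('n) - 1))) *\<^sub>R g x)"

section \<open>Eigenvalues and their elementary symmetric functions\<close>

text \<open>For an indefinite metric \<open>g\<close> the matrix \<open>g\<^sup>-\<^sup>1 A\<close> need not be symmetric, so its eigenvalues are
  taken in \<open>\<complex>\<close>, with algebraic multiplicity. The non-real ones come in conjugate pairs, hence the
  elementary symmetric functions are real and \<open>Re\<close> below loses nothing.\<close>

definition characteristic_poly :: "real ^ 'n::finite ^ 'n \<Rightarrow> complex poly" where
  "characteristic_poly M =
     det (\<chi> i j. (if i = j then [:0, 1:] else 0) - [:complex_of_real (M $ i $ j):])"

definition eigenvalues :: "real ^ 'n::finite ^ 'n \<Rightarrow> complex multiset" where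
  "eigenvalues M = proots (characteristic_poly M)"

text \<open>The pair \<open>(z, i)\<close> is the \<open>i\<close>-th copy of \<open>z\<close> in the multiset.\<close>

definition elem_sym :: "nat \<Rightarrow> complex multiset \<Rightarrow> complex" where
  "elem_sym k X = (\<Sum>S | S \<subseteq> {(z, i). i < count X z} \<and> card S = k. \<Prod>p\<in>S. fst p)"

definition sigma_k :: "nat \<Rightarrow> real ^ 'n::finite ^ 'n \<Rightarrow> real" where
  "sigma_k k M = Re (elem_sym k (eigenvalues M))"

section \<open>Gradient \<open>k\<close>-Yamabe solitons\<close>

text \<open>The Schouten tensor \<open>A\<close> of \<open>g\<close> is a parameter here, because in dimension 2 it is not determined
  by the curvature of \<open>g\<close>; see \<open>conformal_schouten\<close>.\<close>

definition gradient_k_Yamabe_soliton ::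
  "nat \<Rightarrow> (real ^ 'n::finite \<Rightarrow> real ^ 'n ^ 'n) \<Rightarrow> (real ^ 'n \<Rightarrow> real ^ 'n ^ 'n)
     \<Rightarrow> (real ^ 'n \<Rightarrow> real) \<Rightarrow> real \<Rightarrow> bool" where
  "gradient_k_Yamabe_soliton k g A f lam \<longleftrightarrow>
     1 \<le> k \<and> k \<le> CARD('n) \<and> pseudo_Riemannian_metric g \<and> smooth f \<and>
     (\<forall>x. hessian g f x =
        (2 * (real CARD('n) - 1) * (sigma_k k (matrix_inv (g x) ** A x) - lam)) *\<^sub>R g x)"

definition pseudo_Euclidean :: "('n::finite \<Rightarrow> real) \<Rightarrow> real ^ 'n ^ 'n" where
  "pseudo_Euclidean \<epsilon> = (\<chi> i j. if i = j then \<epsilon> i else 0)"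

definition conformal_metric ::
  "('n::finite \<Rightarrow> real) \<Rightarrow> (real ^ 'n \<Rightarrow> real) \<Rightarrow> real ^ 'n \<Rightarrow> real ^ 'n ^ 'n" where
  "conformal_metric \<epsilon> \<phi> x = (1 / (\<phi> x)\<^sup>2) *\<^sub>R pseudo_Euclidean \<epsilon>"

text \<open>In dimension 2 the quotient by \<open>n - 2\<close> is meaningless, and the Schouten tensor of
  \<open>\<delta> / \<phi>\<^sup>2\<close> is by convention \<open>\<nabla>\<^sup>2\<phi> / \<phi> - |\<nabla>\<phi>|\<^sup>2 \<delta> / (2 \<phi>\<^sup>2)\<close>, the expression that in higher
  dimension follows from the curvature formula. As \<open>\<epsilon> i = \<plusminus>1\<close>, the sum below is \<open>|\<nabla>\<phi>|\<^sup>2\<close> with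
  respect to \<open>\<delta>\<close>.\<close>

definition conformal_schouten ::
  "('n::finite \<Rightarrow> real) \<Rightarrow> (real ^ 'n \<Rightarrow> real) \<Rightarrow> real ^ 'n \<Rightarrow> real ^ 'n ^ 'n" where
  "conformal_schouten \<epsilon> \<phi> x =
     (if CARD('n) = 2 then
        (1 / \<phi> x) *\<^sub>R (\<chi> i j. partial i (partial j \<phi>) x)
          - ((\<Sum>i\<in>UNIV. \<epsilon> i * (partial i \<phi> x)\<^sup>2) / (2 * (\<phi> x)\<^sup>2)) *\<^sub>R pseudo_Euclidean \<epsilon>
      else schouten (conformal_metric \<epsilon> \<phi>) x)"

definition steady_conformal_soliton ::
  "nat \<Rightarrow> ('n::finite \<Rightarrow> real) \<Rightarrow> (real ^ 'n \<Rightarrow> real) \<Rightarrow> (real ^ 'n \<Rightarrow> real) \<Rightarrow> bool" where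
  "steady_conformal_soliton k \<epsilon> \<phi> f \<longleftrightarrow>
     gradient_k_Yamabe_soliton k (conformal_metric \<epsilon> \<phi>) (conformal_schouten \<epsilon> \<phi>) f 0"

section \<open>Translation invariance and the explicit solutions\<close>

definition xi :: "real ^ 'n::finite \<Rightarrow> real ^ 'n \<Rightarrow> real" where
  "xi \<alpha> x = (\<Sum>i\<in>UNIV. \<alpha> $ i * x $ i)"

definition translation_invariant :: "real ^ 'n::finite \<Rightarrow> (real ^ 'n \<Rightarrow> real) \<Rightarrow> bool" where
  "translation_invariant \<alpha> h \<longleftrightarrow> (\<exists>H. \<forall>x. h x = H (xi \<alpha> x))"

definition b_const :: "nat \<Rightarrow> nat \<Rightarrow> real" where
  "b_const n k = fact (n - 1) / (fact k * fact (n - k)) * (- 1) ^ (k - 1) * (1 / 2 ^ (k - 1))"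

definition p_const :: "nat \<Rightarrow> nat \<Rightarrow> real \<Rightarrow> real" where
  "p_const n k c =
     c / (2 * (real n - 1) * real k * b_const n k)
       * ((2 * real k - real n) / (2 * real k)) ^ (2 * (k - 1))"

definition bracket :: "nat \<Rightarrow> nat \<Rightarrow> real \<Rightarrow> real \<Rightarrow> real \<Rightarrow> real" where
  "bracket n k c c1 s =
     (real n - 2 * real k) * p_const n k c * (1 - 2 * real k)
         / (2 * real n * real k - real n + 2 * real k)
       * s powr ((2 - real n) / 2
                  * ((2 * real n * real k - real n + 2 * real k) / (real n - 2 * real k)))
     + c1"

text \<open>The exponent \<open>1 / (2k - 1)\<close> is the real odd root, defined for negative brackets as well.\<close>

definition integrand :: "nat \<Rightarrow> nat \<Rightarrow> real \<Rightarrow> real \<Rightarrow> real \<Rightarrow> real" where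
  "integrand n k c c1 s =
     1 / (s powr (real n / (2 * real k)) * root (2 * k - 1) (bracket n k c c1 s))"

definition case_a :: "(real \<Rightarrow> real) \<Rightarrow> (real \<Rightarrow> real) \<Rightarrow> bool" where
  "case_a \<Phi> F \<longleftrightarrow>
     (\<forall>t. deriv \<Phi> t = 0) \<and>
     (\<exists>b c d. 0 < b \<and> (\<forall>t. \<Phi> t = b) \<and> (\<forall>t. F t = c * t + d))"

text \<open>Indefinite integrals are antiderivatives: \<open>J\<close> of \<open>c / \<Phi>\<^sup>2\<close> on the real line, and \<open>H\<close> of the
  integrand on the range of \<open>\<Phi>\<close>, on which its denominator must not vanish.\<close>

definition case_b :: "nat \<Rightarrow> nat \<Rightarrow> (real \<Rightarrow> real) \<Rightarrow> (real \<Rightarrow> real) \<Rightarrow> bool" where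
  "case_b n k \<Phi> F \<longleftrightarrow>
     (\<forall>t. deriv \<Phi> t \<noteq> 0) \<and>
     (\<exists>c d c1 c2.
        (\<exists>J. (\<forall>t. (J has_real_derivative c / (\<Phi> t)\<^sup>2) (at t)) \<and> (\<forall>t. F t = J t + d)) \<and>
        (\<exists>H. (\<forall>s\<in>range \<Phi>. bracket n k c c1 s \<noteq> 0 \<and>
                 (H has_real_derivative integrand n k c c1 s) (at s)) \<and>
             (\<forall>t. H (\<Phi> t) = 2 * real k / (2 * real k - real n) * t + c2)))"

end

theory Submission
  imports Defs
begin

text \<open>If \<open>\<phi> = \<Phi>(\<xi>)\<close> and \<open>f = F(\<xi>)\<close>, then the Christoffel symbols of \<open>\<delta> / \<phi>\<^sup>2\<close> are \<open>- \<Phi>' / \<Phi>\<close> times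
  constants, and with \<open>N = |\<alpha>|\<^sup>2\<close> the Schouten tensor is
  \<open>(\<Phi>'' / \<Phi>) \<alpha> \<otimes> \<alpha> - (N / 2) (\<Phi>' / \<Phi>)\<^sup>2 \<delta>\<close>. The Hessian of \<open>f\<close> is also a combination of \<open>\<alpha> \<otimes> \<alpha>\<close>
  and \<open>\<delta>\<close>. From dimension 2 on these two forms are linearly independent
  (\<open>rank_one_eq_diagonal_imp_zero\<close>), so the soliton equation splits. The coefficient of \<open>\<alpha> \<otimes> \<alpha>\<close> gives
  \<open>F'' + 2 (\<Phi>' / \<Phi>) F' = 0\<close>, that is, \<open>F' \<Phi>\<^sup>2 = c\<close> is constant. For the coefficient of \<open>\<delta>\<close> one needs
  \<open>\<sigma>\<^sub>k\<close> of a multiple of the identity plus a matrix of rank one, whose eigenvalues are known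
  (\<open>eigenvalues_scalar_plus_rank_one\<close>). With \<open>m = k - 1\<close>, \<open>a = n / (2 k)\<close> and a multiple \<open>K\<close> of \<open>c\<close>
  it becomes
  \<open>(\<Phi>')^(2 m) (\<Phi> \<Phi>'' - a (\<Phi>')\<^sup>2) = K \<Phi>' / \<Phi>\<close>.

  The decisive point is a Liouville theorem: a positive solution of this equation on the \<^emph>\<open>whole\<close>
  real line is constant. The function \<open>w = \<Phi>' \<Phi>^(- a)\<close> has the sign of \<open>\<Phi>'\<close> and satisfies a first
  integral \<open>w^(2 m + 1) = c\<^sub>0 - C \<Phi>^(- \<beta>)\<close> with \<open>\<beta> > 0\<close>. If \<open>\<Phi>'\<close> were nonzero somewhere, then following
  \<open>\<Phi>\<close> in a suitable direction one of three things happens in finite time: \<open>\<Phi>\<close> falls below 0, or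
  \<open>\<Phi>^(1 - a)\<close> does, or \<open>w\<close> reaches 0 with an infinite slope. Each contradicts positivity or
  smoothness. The condition \<open>n \<noteq> 2 k\<close> enters as \<open>a \<noteq> 1\<close>, and for \<open>k = 1\<close>,
  where \<open>w\<close> cannot reach 0 in finite time, \<open>n > 2\<close> gives \<open>a > 1\<close>.

  So an invariant steady soliton has \<open>\<Phi>' = 0\<close>, hence \<open>F'' = 0\<close>, which is case (a). Conversely, both (a)
  and (b) speak of functions of \<open>\<xi>\<close>, so they include the invariance.\<close>

section \<open>A Liouville theorem for the profile equation\<close>

lemma last_zero_before:
  fixes g :: "real \<Rightarrow> real"
  assumes cont: "\<And>t. isCont g t" and "g t\<^sub>1 \<le> 0" "t\<^sub>1 \<le> t\<^sub>0" "0 < g t\<^sub>0"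
  obtains T where "T < t\<^sub>0" "g T = 0" "\<And>s. T < s \<Longrightarrow> s \<le> t\<^sub>0 \<Longrightarrow> 0 < g s"
proof -
  define Z where "Z = {t. g t \<le> 0} \<inter> {t\<^sub>1..t\<^sub>0}"
  have "closed {t. g t \<le> 0}"
    by (intro closed_Collect_le continuous_at_imp_continuous_on) (auto simp: cont)
  then have "compact Z"
    unfolding Z_def by (intro closed_Int_compact) auto
  moreover have "t\<^sub>1 \<in> Z" using assms by (auto simp: Z_def)
  ultimately obtain T where T: "T \<in> Z" "\<And>t. t \<in> Z \<Longrightarrow> t \<le> T"
    using compact_attains_sup[of Z] by blast
  have "T < t\<^sub>0" using T(1) assms(4) by (auto simp: Z_def order.order_iff_strict)
  have after: "0 < g s" if "T < s" "s \<le> t\<^sub>0" for s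
  proof (rule ccontr)
    assume "\<not> 0 < g s"
    with T(1) that have "s \<in> Z" by (auto simp: Z_def)
    with T(2) that show False by force
  qed
  have "g T = 0"
  proof (rule ccontr)
    assume "g T \<noteq> 0"
    then have "g T < 0" using T(1) by (auto simp: Z_def)
    then obtain s where "T \<le> s" "s \<le> t\<^sub>0" "g s = 0"
      using IVT[of g T 0 t\<^sub>0] cont assms(4) \<open>T < t\<^sub>0\<close> by force
    then show False using after[of s] \<open>g T < 0\<close> by (cases "s = T") auto
  qed
  then show ?thesis using that[of T] T(1) \<open>T < t\<^sub>0\<close> after by (auto simp: Z_def)
qed

text \<open>Every contradiction with positivity below comes from a positive quantity whose slope stays above
  some \<open>\<delta> > 0\<close> all the way to \<open>-\<infinity>\<close>.\<close>

lemma decreases_without_bound: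
  fixes u :: "real \<Rightarrow> real"
  assumes u: "\<And>t. t \<le> t\<^sub>0 \<Longrightarrow> (u has_real_derivative u' t) (at t)"
    and ge: "\<And>t. t \<le> t\<^sub>0 \<Longrightarrow> \<delta> \<le> u' t" and "0 < \<delta>"
  obtains t where "t \<le> t\<^sub>0" "u t < 0"
proof -
  have le: "u t \<le> u t\<^sub>0 - \<delta> * (t\<^sub>0 - t)" if "t \<le> t\<^sub>0" for t
  proof -
    have "u t - \<delta> * t \<le> u t\<^sub>0 - \<delta> * t\<^sub>0"
    proof (rule DERIV_nonneg_imp_nondecreasing[OF that])
      fix s assume s: "t \<le> s" "s \<le> t\<^sub>0"
      have "((\<lambda>s. u s - \<delta> * s) has_real_derivative u' s - \<delta>) (at s)"
        using u[OF s(2)] by (auto intro!: derivative_eq_intros)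
      then show "\<exists>y. ((\<lambda>s. u s - \<delta> * s) has_real_derivative y) (at s) \<and> 0 \<le> y"
        using ge[OF s(2)] by force
    qed
    then show ?thesis by (simp add: algebra_simps)
  qed
  define t where "t = t\<^sub>0 - (\<bar>u t\<^sub>0\<bar> + 1) / \<delta>"
  have t: "t \<le> t\<^sub>0" using \<open>0 < \<delta>\<close> by (simp add: t_def)
  have "\<delta> * (t\<^sub>0 - t) = \<bar>u t\<^sub>0\<bar> + 1" using \<open>0 < \<delta>\<close> by (simp add: t_def)
  with le[OF t] have "u t < 0" by linarith
  with t that show ?thesis by blast
qed

text \<open>The equation satisfied by the conformal factor of an invariant steady soliton. Writing \<open>m\<close> for
  \<open>k - 1\<close> and \<open>a\<close> for \<open>n / (2 k)\<close> keeps the exponents free of subtraction.\<close>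

locale profile_ode =
  fixes \<Phi> \<Phi>1 \<Phi>2 :: "real \<Rightarrow> real" and m :: nat and a K :: real
  assumes pos: "0 < \<Phi> t"
    and D1: "(\<Phi> has_real_derivative \<Phi>1 t) (at t)"
    and D2: "(\<Phi>1 has_real_derivative \<Phi>2 t) (at t)"
    and a_pos: "0 < a"
    and ode: "\<Phi>1 t ^ (2 * m) * (\<Phi> t * \<Phi>2 t - a * (\<Phi>1 t)\<^sup>2) = K * \<Phi>1 t / \<Phi> t"
begin

text \<open>Up to the factor \<open>1 - a\<close>, \<open>w\<close> is the slope of \<open>\<Phi>^(1 - a)\<close> (see \<open>u_deriv\<close>). It is the right
  unknown because the bracket \<open>\<Phi> \<Phi>'' - a (\<Phi>')\<^sup>2\<close> of the equation is \<open>w'\<close> up to a power of \<open>\<Phi>\<close>.\<close>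

definition w :: "real \<Rightarrow> real" where
  "w t = \<Phi>1 t * \<Phi> t powr (- a)"

definition w' :: "real \<Rightarrow> real" where
  "w' t = \<Phi> t powr (- a - 1) * (\<Phi> t * \<Phi>2 t - a * (\<Phi>1 t)\<^sup>2)"

lemma w_pos_iff: "0 < w t \<longleftrightarrow> 0 < \<Phi>1 t"
  using pos[of t] by (simp add: w_def zero_less_mult_iff)

lemma w_deriv: "(w has_real_derivative w' t) (at t)"
proof -
  have *: "\<Phi> t powr (- a) = \<Phi> t powr (- a - 1) * \<Phi> t"
    using pos[of t] powr_add[of "\<Phi> t" "-a-1" 1] by simp
  have "((\<lambda>t. \<Phi>1 t * \<Phi> t powr (- a)) has_real_derivative
      \<Phi>2 t * \<Phi> t powr (- a) + (- a * \<Phi> t powr (- a - 1) * \<Phi>1 t) * \<Phi>1 t) (at t)"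
    using DERIV_mult[OF D2 DERIV_chain2[OF has_real_derivative_powr[OF pos] D1]] .
  moreover have "\<Phi>2 t * \<Phi> t powr (- a) + (- a * \<Phi> t powr (- a - 1) * \<Phi>1 t) * \<Phi>1 t = w' t"
    unfolding w'_def * by (simp add: algebra_simps power2_eq_square)
  ultimately show ?thesis by (simp add: w_def[abs_def])
qed

lemma w_cont: "isCont w t"
  using w_deriv DERIV_isCont by blast

lemma u_deriv: "((\<lambda>t. \<Phi> t powr (1 - a)) has_real_derivative (1 - a) * w t) (at t)"
  using DERIV_chain2[OF has_real_derivative_powr[OF pos] D1, of "1 - a" t]
  by (simp add: w_def mult_ac)

lemma w_ode: "w t ^ (2 * m) * w' t = K * w t * \<Phi> t powr (- (2 + 2 * a * m))"
proof -
  have p: "\<Phi> t powr (- (2 + 2 * a * m)) = (\<Phi> t powr (- a)) ^ (2 * m) / (\<Phi> t)\<^sup>2"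
  proof -
    have "\<Phi> t powr (- (2 + 2 * a * m)) = \<Phi> t powr (- 2) * \<Phi> t powr (real (2 * m) * (- a))"
      unfolding powr_add[symmetric] by (simp add: mult_ac)
    also have "\<Phi> t powr (real (2 * m) * (- a)) = (\<Phi> t powr (- a)) ^ (2 * m)"
      using pos[of t] by (subst powr_power) auto
    also have "\<Phi> t powr (- 2) = 1 / (\<Phi> t)\<^sup>2"
      using pos[of t] by (simp add: powr_minus divide_inverse)
    finally show ?thesis by simp
  qed
  have q: "\<Phi> t powr (- a - 1) = \<Phi> t powr (- a) / \<Phi> t"
    using pos[of t] by (simp add: powr_diff)
  have "w t ^ (2 * m) * w' t
      = (\<Phi> t powr (- a)) ^ (2 * m) * \<Phi> t powr (- a) / \<Phi> t
        * (\<Phi>1 t ^ (2 * m) * (\<Phi> t * \<Phi>2 t - a * (\<Phi>1 t)\<^sup>2))"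
    unfolding w_def w'_def q by (simp add: power_mult_distrib)
  also have "\<dots> = K * w t * \<Phi> t powr (- (2 + 2 * a * m))"
    unfolding ode p w_def using pos[of t] by (simp add: power2_eq_square)
  finally show ?thesis .
qed

definition \<beta> :: real where "\<beta> = 1 + a * (2 * m + 1)"
definition C :: real where "C = (2 * m + 1) * K / \<beta>"

lemma \<beta>_pos: "0 < \<beta>"
  using a_pos by (simp add: \<beta>_def add_pos_nonneg)

lemma C_pos_iff: "0 < C \<longleftrightarrow> 0 < K"
  using \<beta>_pos by (simp add: C_def zero_less_divide_iff zero_less_mult_iff)

text \<open>By \<open>w_ode\<close>, \<open>(w^(2 m + 1))'\<close> is a constant times \<open>\<Phi>'\<close> times a power of \<open>\<Phi>\<close>, which integrates
  to a power of \<open>\<Phi>\<close>. The exponent \<open>- \<beta>\<close> is never 0, so no logarithm appears.\<close>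

lemma first_integral:
  obtains c where "\<And>t. w t ^ (2 * m + 1) = c - C * \<Phi> t powr (- \<beta>)"
proof -
  let ?E = "\<lambda>t. w t ^ (2 * m + 1) + C * \<Phi> t powr (- \<beta>)"
  have "(?E has_real_derivative 0) (at t)" for t
  proof -
    have e: "\<Phi> t powr (- \<beta> - 1) = \<Phi> t powr (- (2 + 2 * a * m)) * \<Phi> t powr (- a)"
      by (simp add: \<beta>_def algebra_simps flip: powr_add)
    have "(?E has_real_derivative
        (2 * m + 1) * w t ^ (2 * m) * w' t + C * (- \<beta> * \<Phi> t powr (- \<beta> - 1) * \<Phi>1 t)) (at t)"
      using DERIV_power[OF w_deriv, of "2 * m + 1" t]
      by (intro DERIV_add DERIV_cmult DERIV_chain2[OF has_real_derivative_powr[OF pos] D1])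
         (simp add: mult_ac)
    moreover have "(2 * m + 1) * w t ^ (2 * m) * w' t = (2 * m + 1) * (w t ^ (2 * m) * w' t)"
      by simp
    then have "(2 * m + 1) * w t ^ (2 * m) * w' t + C * (- \<beta> * \<Phi> t powr (- \<beta> - 1) * \<Phi>1 t) = 0"
      unfolding w_ode e using \<beta>_pos by (simp add: C_def w_def)
    ultimately show ?thesis by simp
  qed
  then have "?E t = ?E 0" for t by (intro DERIV_isconst_all) auto
  then show ?thesis using that[of "?E 0"] by (metis add_diff_cancel_right')
qed

lemma \<Phi>1_cont: "isCont \<Phi>1 t"
  using D2 DERIV_isCont by blast

lemma \<Phi>_le_backward:
  assumes "\<And>s. t \<le> s \<Longrightarrow> s \<le> t\<^sub>0 \<Longrightarrow> 0 \<le> \<Phi>1 s" "t \<le> t\<^sub>0"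
  shows "\<Phi> t \<le> \<Phi> t\<^sub>0"
  using assms(2) by (rule DERIV_nonneg_imp_nondecreasing) (use assms(1) D1 in blast)

text \<open>In the form \<open>\<Phi> (\<Phi>')^(2 m + 1) = c \<Phi>^\<beta> - C\<close> the first integral has a right-hand side that is monotone
  in \<open>\<Phi>\<close> and tends to \<open>- C > 0\<close> as \<open>\<Phi> \<rightarrow> 0\<close>. So if \<open>\<Phi>\<close> increases at \<open>t\<^sub>0\<close>, then on the way back to smaller
  values of \<open>\<Phi>\<close> the left-hand side stays above some \<open>q > 0\<close>, and \<open>\<Phi>\<close> would become negative.\<close>

lemma not_increasing_C_neg:
  assumes "C < 0"
  shows "\<not> 0 < \<Phi>1 t\<^sub>0"
proof
  assume t0: "0 < \<Phi>1 t\<^sub>0"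
  obtain c where c: "\<And>t. w t ^ (2 * m + 1) = c - C * \<Phi> t powr (- \<beta>)"
    using first_integral by blast
  have pow: "0 < w t \<longleftrightarrow> 0 < w t ^ (2 * m + 1)" for t
    by (simp only: zero_less_power_eq) auto
  have w_backward: "w t\<^sub>0 ^ (2 * m + 1) \<le> w t ^ (2 * m + 1)" if "\<Phi> t \<le> \<Phi> t\<^sub>0" for t
  proof -
    have "\<Phi> t\<^sub>0 powr (- \<beta>) \<le> \<Phi> t powr (- \<beta>)"
      using that pos[of t] \<beta>_pos by (intro powr_mono2') auto
    then show ?thesis unfolding c using \<open>C < 0\<close> by simp
  qed
  have \<Phi>1_pos: "0 < \<Phi>1 t" if "t \<le> t\<^sub>0" for t
  proof (rule ccontr)
    assume "\<not> 0 < \<Phi>1 t"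
    then have "\<Phi>1 t \<le> 0" by simp
    from last_zero_before[OF \<Phi>1_cont this that t0] obtain T where T: "T < t\<^sub>0" "\<Phi>1 T = 0" "\<And>s. T < s \<Longrightarrow> s \<le> t\<^sub>0 \<Longrightarrow> 0 < \<Phi>1 s" by blast
    have "\<Phi> T \<le> \<Phi> t\<^sub>0"
      using T by (intro \<Phi>_le_backward) (auto simp: order.order_iff_strict)
    from w_backward[OF this] t0 have "0 < w T"
      using pow w_pos_iff by (meson order_less_le_trans)
    then show False using T(2) by (simp add: w_pos_iff)
  qed
  have \<Phi>_le: "\<Phi> t \<le> \<Phi> t\<^sub>0" if "t \<le> t\<^sub>0" for t
    using \<Phi>1_pos that by (intro \<Phi>_le_backward) (auto simp: less_imp_le)
  (* the right-hand side c * s^beta - C is monotone in s, hence on (0, Phi t0] at least the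
     smaller of its values at the two ends *)
  define q where "q = min (- C) (\<Phi> t\<^sub>0 powr \<beta> * w t\<^sub>0 ^ (2 * m + 1))"
  have "0 < q"
    using \<open>C < 0\<close> t0 pos[of t\<^sub>0] pow[of t\<^sub>0] by (simp add: q_def w_pos_iff)
  have eq: "\<Phi> t * \<Phi>1 t ^ (2 * m + 1) = c * \<Phi> t powr \<beta> - C" for t
  proof -
    have "w t ^ (2 * m + 1) = \<Phi>1 t ^ (2 * m + 1) * (\<Phi> t powr (- a)) ^ (2 * m + 1)"
      unfolding w_def power_mult_distrib ..
    also have "(\<Phi> t powr (- a)) ^ (2 * m + 1) = \<Phi> t powr (1 - \<beta>)"
      using pos[of t] by (subst powr_power) (auto simp: \<beta>_def algebra_simps)
    also have "\<Phi> t powr (1 - \<beta>) = \<Phi> t / \<Phi> t powr \<beta>"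
      using pos[of t] by (simp add: powr_diff)
    finally have "\<Phi>1 t ^ (2 * m + 1) * (\<Phi> t / \<Phi> t powr \<beta>) = c - C / \<Phi> t powr \<beta>"
      unfolding c by (simp add: powr_minus divide_inverse)
    then show ?thesis using pos[of t] by (simp add: field_simps)
  qed
  have q_le: "q \<le> \<Phi> t * \<Phi>1 t ^ (2 * m + 1)" if "t \<le> t\<^sub>0" for t
  proof (cases "0 \<le> c")
    case True
    then have "0 \<le> c * \<Phi> t powr \<beta>" by simp
    then show ?thesis unfolding eq q_def by linarith
  next
    case False
    have "\<Phi> t powr \<beta> \<le> \<Phi> t\<^sub>0 powr \<beta>"
      using \<Phi>_le[OF that] pos[of t] \<beta>_pos by (intro powr_mono2) auto
    with False have "c * \<Phi> t\<^sub>0 powr \<beta> \<le> c * \<Phi> t powr \<beta>" by simp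
    moreover have "\<Phi> t\<^sub>0 powr \<beta> * w t\<^sub>0 ^ (2 * m + 1) = c * \<Phi> t\<^sub>0 powr \<beta> - C"
      unfolding c using pos[of t\<^sub>0] by (simp add: algebra_simps flip: powr_add)
    ultimately show ?thesis unfolding eq q_def by linarith
  qed
  (* a lower bound for the slope that avoids taking odd roots: either Phi1 > 1, or
     Phi1^(2m+1) <= Phi1 *)
  define \<delta> where "\<delta> = min 1 (q / \<Phi> t\<^sub>0)"
  have "0 < \<delta>" using \<open>0 < q\<close> pos by (simp add: \<delta>_def)
  have "\<delta> \<le> \<Phi>1 t" if "t \<le> t\<^sub>0" for t
  proof (cases "\<Phi>1 t \<le> 1")
    case True
    have "q \<le> \<Phi> t * \<Phi>1 t ^ (2 * m + 1)" by (rule q_le[OF that])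
    also have "\<dots> \<le> \<Phi> t\<^sub>0 * \<Phi>1 t"
      using True \<Phi>1_pos[OF that] \<Phi>_le[OF that] pos[of t\<^sub>0] power_decreasing[of 1 "2 * m + 1" "\<Phi>1 t"]
      by (intro mult_mono) auto
    finally show ?thesis
      using pos[of t\<^sub>0] by (simp add: \<delta>_def min_le_iff_disj divide_le_eq mult.commute)
  qed (simp add: \<delta>_def)
  then obtain t where "\<Phi> t < 0"
    using decreases_without_bound[of t\<^sub>0 \<Phi> \<Phi>1 \<delta>] D1 \<open>0 < \<delta>\<close> by blast
  with pos[of t] show False by simp
qed

text \<open>If \<open>\<Phi>\<close> decreases at \<open>t\<^sub>0\<close>, then \<open>\<Phi>\<close> is larger at earlier times, and for \<open>C \<le> 0\<close> the first
  integral makes \<open>w\<close> at least as negative there. For \<open>a > 1\<close> the positive function \<open>\<Phi>^(1 - a)\<close> then has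
  slope at least \<open>(1 - a) w(t\<^sub>0) > 0\<close> on \<open>(-\<infinity>, t\<^sub>0]\<close>: read forward from an early time, \<open>\<Phi>\<close> comes down
  from infinity in finite time.\<close>

lemma not_decreasing_a_gt_1:
  assumes "C \<le> 0" "1 < a"
  shows "\<not> \<Phi>1 t\<^sub>0 < 0"
proof
  assume t0: "\<Phi>1 t\<^sub>0 < 0"
  obtain c where c: "\<And>t. w t ^ (2 * m + 1) = c - C * \<Phi> t powr (- \<beta>)"
    using first_integral by blast
  have w_neg_iff: "w t < 0 \<longleftrightarrow> \<Phi>1 t < 0" for t
    using pos[of t] by (simp add: w_def mult_less_0_iff)
  have w_backward: "w t \<le> w t\<^sub>0" if "\<Phi> t\<^sub>0 \<le> \<Phi> t" for t
  proof -
    have "\<Phi> t powr (- \<beta>) \<le> \<Phi> t\<^sub>0 powr (- \<beta>)"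
      using that pos[of t\<^sub>0] \<beta>_pos by (intro powr_mono2') auto
    then have "w t ^ (2 * m + 1) \<le> w t\<^sub>0 ^ (2 * m + 1)"
      unfolding c using \<open>C \<le> 0\<close> by (simp add: mult_left_mono_neg)
    then have "(- w t\<^sub>0) ^ Suc (2 * m) \<le> (- w t) ^ Suc (2 * m)"
      by simp
    moreover from this have "0 < (- w t) ^ Suc (2 * m)"
      using t0 w_neg_iff[of t\<^sub>0] zero_less_power[of "- w t\<^sub>0" "Suc (2 * m)"] by linarith
    then have "0 \<le> - w t"
      by (simp only: zero_less_power_eq) auto
    ultimately have "- w t\<^sub>0 \<le> - w t"
      by (rule power_le_imp_le_base)
    then show ?thesis by simp
  qed
  have \<Phi>_ge: "\<Phi> t\<^sub>0 \<le> \<Phi> t" if "\<And>s. t \<le> s \<Longrightarrow> s \<le> t\<^sub>0 \<Longrightarrow> \<Phi>1 s \<le> 0" "t \<le> t\<^sub>0" for t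
    using that(2) by (rule DERIV_nonpos_imp_nonincreasing) (use that(1) D1 in blast)
  have \<Phi>1_neg: "\<Phi>1 t < 0" if "t \<le> t\<^sub>0" for t
  proof (rule ccontr)
    assume "\<not> \<Phi>1 t < 0"
    then have "- \<Phi>1 t \<le> 0" "0 < - \<Phi>1 t\<^sub>0" using t0 by auto
    from last_zero_before[OF isCont_minus[OF \<Phi>1_cont] this(1) that this(2)]
    obtain T where T: "T < t\<^sub>0" "\<Phi>1 T = 0" "\<And>s. T < s \<Longrightarrow> s \<le> t\<^sub>0 \<Longrightarrow> \<Phi>1 s < 0"
      by auto
    have "\<Phi> t\<^sub>0 \<le> \<Phi> T"
      using T by (intro \<Phi>_ge) (auto simp: order.order_iff_strict)
    from w_backward[OF this] t0 have "w T < 0"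
      using w_neg_iff[of t\<^sub>0] by linarith
    then show False using T(2) by (simp add: w_neg_iff)
  qed
  have "(a - 1) * - w t\<^sub>0 \<le> (1 - a) * w t" if "t \<le> t\<^sub>0" for t
  proof -
    have "\<Phi> t\<^sub>0 \<le> \<Phi> t"
      using \<Phi>1_neg that by (intro \<Phi>_ge) (auto simp: less_imp_le)
    from w_backward[OF this] \<open>1 < a\<close> have "(a - 1) * - w t\<^sub>0 \<le> (a - 1) * - w t"
      by (intro mult_left_mono) auto
    then show ?thesis by (simp add: algebra_simps)
  qed
  moreover have "0 < (a - 1) * - w t\<^sub>0"
    using \<open>1 < a\<close> t0 w_neg_iff[of t\<^sub>0] by (simp add: mult_less_0_iff)
  ultimately obtain t where "\<Phi> t powr (1 - a) < 0"
    using decreases_without_bound[OF u_deriv] by blast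
  then show False by (simp add: not_less[symmetric])
qed

text \<open>For \<open>C = 0\<close> the function \<open>w\<close> is constant and \<open>\<Phi>^(1 - a)\<close> is affine.\<close>

lemma not_increasing_C_zero:
  assumes "C = 0" "a < 1"
  shows "\<not> 0 < \<Phi>1 t\<^sub>0"
proof
  assume t0: "0 < \<Phi>1 t\<^sub>0"
  obtain c where c: "\<And>t. w t ^ (2 * m + 1) = c - C * \<Phi> t powr (- \<beta>)"
    using first_integral by blast
  have "w t = w t\<^sub>0" for t
  proof -
    have eq: "w t ^ Suc (2 * m) = w t\<^sub>0 ^ Suc (2 * m)"
      using c \<open>C = 0\<close> by simp
    have t0': "0 < w t\<^sub>0" using t0 by (simp add: w_pos_iff)
    then have "0 < w t ^ Suc (2 * m)" unfolding eq by simp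
    then have "0 \<le> w t" by (simp only: zero_less_power_eq) auto
    with eq t0' show ?thesis by (metis less_imp_le power_inject_base)
  qed
  then have "(1 - a) * w t\<^sub>0 \<le> (1 - a) * w t" for t by (metis order_refl)
  moreover have "0 < (1 - a) * w t\<^sub>0"
    using \<open>a < 1\<close> t0 by (simp add: w_pos_iff)
  ultimately obtain t where "\<Phi> t powr (1 - a) < 0"
    using decreases_without_bound[OF u_deriv] by blast
  then show False by (simp add: not_less[symmetric])
qed

text \<open>Here \<open>w\<close> decreases backward, and \<open>w_ode\<close> divided by \<open>w\<close> bounds \<open>(w^(2 m))'\<close> below by some \<open>\<delta> > 0\<close> as
  long as \<open>w > 0\<close>. Hence \<open>w\<close> has to vanish at some \<open>T < t\<^sub>0\<close>, with \<open>w(T + h)^(2 m) \<ge> \<delta> h\<close>. For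
  \<open>m \<ge> 1\<close> this square-root-like behaviour is incompatible with differentiability of \<open>w\<close> at \<open>T\<close>, since
  then \<open>w^(2 m)\<close> has derivative 0 there.\<close>

lemma not_increasing_C_pos:
  assumes "0 < C" "1 \<le> m"
  shows "\<not> 0 < \<Phi>1 t\<^sub>0"
proof
  assume t0: "0 < \<Phi>1 t\<^sub>0"
  define \<gamma> where "\<gamma> = 2 + 2 * a * m"
  have "0 < \<gamma>" using a_pos by (simp add: \<gamma>_def add_pos_nonneg)
  define F where "F t = w t ^ (2 * m)" for t
  define \<delta> where "\<delta> = 2 * m * K * \<Phi> t\<^sub>0 powr (- \<gamma>)"
  have "0 < K" using \<open>0 < C\<close> C_pos_iff by simp
  then have "0 < \<delta>" using \<open>1 \<le> m\<close> pos[of t\<^sub>0] by (simp add: \<delta>_def)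
  have F_deriv: "(F has_real_derivative 2 * m * w t ^ (2 * m - 1) * w' t) (at t)" for t
    using DERIV_power[OF w_deriv, of "2 * m" t] by (simp add: F_def[abs_def] mult_ac)
  have F_deriv_pos: "\<exists>l\<ge>\<delta>. (F has_real_derivative l) (at t)"
    if "\<And>s. t \<le> s \<Longrightarrow> s \<le> t\<^sub>0 \<Longrightarrow> 0 < w s" "t \<le> t\<^sub>0" for t
  proof -
    have "0 < w t" using that by simp
    moreover have "w t * (w t ^ (2 * m - 1) * w' t) = K * w t * \<Phi> t powr (- \<gamma>)"
      using w_ode[of t] \<open>1 \<le> m\<close> unfolding \<gamma>_def
      by (simp flip: mult.assoc power_Suc)
    ultimately have "2 * m * w t ^ (2 * m - 1) * w' t = 2 * m * K * \<Phi> t powr (- \<gamma>)"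
      by (simp add: mult_ac)
    moreover have "\<Phi> t \<le> \<Phi> t\<^sub>0"
      using that by (intro \<Phi>_le_backward) (auto simp: w_pos_iff less_imp_le)
    then have "\<Phi> t\<^sub>0 powr (- \<gamma>) \<le> \<Phi> t powr (- \<gamma>)"
      using pos[of t] \<open>0 < \<gamma>\<close> by (intro powr_mono2') auto
    then have "\<delta> \<le> 2 * m * K * \<Phi> t powr (- \<gamma>)"
      unfolding \<delta>_def using \<open>0 < K\<close> by (intro mult_left_mono) auto
    ultimately show ?thesis using F_deriv[of t] by metis
  qed
  show False
  proof (cases "\<forall>t\<le>t\<^sub>0. 0 < w t")
    case True
    then have "\<forall>t\<le>t\<^sub>0. \<exists>l\<ge>\<delta>. (F has_real_derivative l) (at t)"
      using F_deriv_pos by auto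
    then obtain F' where "\<And>t. t \<le> t\<^sub>0 \<Longrightarrow> \<delta> \<le> F' t"
      and "\<And>t. t \<le> t\<^sub>0 \<Longrightarrow> (F has_real_derivative F' t) (at t)"
      by metis
    then obtain t where "F t < 0"
      using decreases_without_bound[of t\<^sub>0 F F' \<delta>] \<open>0 < \<delta>\<close> by blast
    then show False by (simp add: F_def)
  next
    case False
    then obtain t\<^sub>1 where "t\<^sub>1 \<le> t\<^sub>0" "w t\<^sub>1 \<le> 0" by (auto simp: not_less)
    moreover have "0 < w t\<^sub>0" using t0 by (simp add: w_pos_iff)
    ultimately obtain T where T: "T < t\<^sub>0" "w T = 0" and after: "\<And>s. T < s \<Longrightarrow> s \<le> t\<^sub>0 \<Longrightarrow> 0 < w s"
      using last_zero_before[OF w_cont] by blast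
    have ge: "\<delta> * h \<le> F (T + h)" if h: "0 < h" "h \<le> t\<^sub>0 - T" for h
    proof -
      have "continuous_on {T..T + h} F"
        using F_deriv DERIV_isCont by (intro continuous_at_imp_continuous_on) blast
      moreover have "F differentiable (at x)" for x
        using F_deriv real_differentiable_def by blast
      ultimately obtain l z where lz: "T < z" "z < T + h" "DERIV F z :> l"
        "F (T + h) - F T = (T + h - T) * l"
        using MVT[of T "T + h" F] h(1) by auto
      obtain l' where "\<delta> \<le> l'" "DERIV F z :> l'"
        using F_deriv_pos[of z] after lz(1,2) h(2) by force
      with lz(3) have "\<delta> \<le> l" using DERIV_unique by blast
      moreover have "F T = 0" using T(2) \<open>1 \<le> m\<close> by (simp add: F_def)
      ultimately show ?thesis
        using lz(4) h(1) by (simp add: mult.commute)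
    qed
    have "(F has_real_derivative 0) (at T)"
      using F_deriv[of T] T(2) \<open>1 \<le> m\<close> by (simp add: power_0_left split: if_splits)
    then have "((\<lambda>t. F t - \<delta> / 2 * t) has_real_derivative - (\<delta> / 2)) (at T)"
      by (auto intro!: derivative_eq_intros)
    then obtain d where "0 < d"
      and d: "\<And>h. 0 < h \<Longrightarrow> h < d \<Longrightarrow> F (T + h) - \<delta> / 2 * (T + h) < F T - \<delta> / 2 * T"
      using DERIV_neg_dec_right[of "\<lambda>t. F t - \<delta> / 2 * t" "- (\<delta> / 2)" T] \<open>0 < \<delta>\<close> by auto
    define h where "h = min (d / 2) (t\<^sub>0 - T)"
    have h: "0 < h" "h < d" "h \<le> t\<^sub>0 - T"
      using \<open>0 < d\<close> T(1) by (auto simp: h_def min_def)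
    have "F T = 0" using T(2) \<open>1 \<le> m\<close> by (simp add: F_def)
    then have "F (T + h) < \<delta> / 2 * h"
      using d[OF h(1,2)] by (simp add: algebra_simps)
    moreover have "0 < \<delta> * h" using \<open>0 < \<delta>\<close> h(1) by simp
    ultimately show False using ge[OF h(1,3)] by simp
  qed
qed

text \<open>Time reversal changes the signs of \<open>\<Phi>'\<close>, \<open>K\<close> and \<open>C\<close>. It turns each of the statements above, about
  \<open>(-\<infinity>, t\<^sub>0]\<close>, into its counterpart on \<open>[t\<^sub>0, \<infinity>)\<close>.\<close>

lemma reflected: "profile_ode (\<lambda>t. \<Phi> (- t)) (\<lambda>t. - \<Phi>1 (- t)) (\<lambda>t. \<Phi>2 (- t)) m a (- K)"
proof
  fix t
  have m: "((\<lambda>t. - t) has_real_derivative - 1) (at t)"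
    by (auto intro!: derivative_eq_intros)
  show "0 < \<Phi> (- t)" by (rule pos)
  show "((\<lambda>t. \<Phi> (- t)) has_real_derivative - \<Phi>1 (- t)) (at t)"
    using DERIV_chain2[OF D1 m] by simp
  show "((\<lambda>t. - \<Phi>1 (- t)) has_real_derivative \<Phi>2 (- t)) (at t)"
    using DERIV_minus[OF DERIV_chain2[OF D2 m]] by simp
  show "0 < a" by (rule a_pos)
  show "(- \<Phi>1 (- t)) ^ (2 * m) * (\<Phi> (- t) * \<Phi>2 (- t) - a * (- \<Phi>1 (- t))\<^sup>2)
      = - K * - \<Phi>1 (- t) / \<Phi> (- t)"
    using ode[of "- t"] by simp
qed

lemma C_eq: "C = K * ((2 * m + 1) / (1 + a * (2 * m + 1)))"
  by (simp add: C_def \<beta>_def)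

text \<open>The sign of \<open>C\<close> and the position of \<open>a\<close> relative to 1 decide which of the mechanisms applies. Some
  cases need it run in the opposite direction of time, that is, for the reflected equation.\<close>

lemma liouville:
  assumes "a \<noteq> 1" and "m = 0 \<Longrightarrow> 1 < a"
  shows "\<Phi>1 t = 0"
proof -
  interpret refl: profile_ode "\<lambda>t. \<Phi> (- t)" "\<lambda>t. - \<Phi>1 (- t)" "\<lambda>t. \<Phi>2 (- t)" m a "- K"
    by (rule reflected)
  have C: "refl.C = - C" by (simp add: refl.C_eq C_eq)
  have "\<not> 0 < \<Phi>1 t"
  proof (cases "C < 0")
    case True
    then show ?thesis by (rule not_increasing_C_neg)
  next
    case False
    show ?thesis
    proof (cases "1 < a")
      case True
      then show ?thesis using refl.not_decreasing_a_gt_1[of "- t"] False C by simp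
    next
      case a: False
      with assms have "a < 1" "1 \<le> m" by (auto simp: Suc_le_eq)
      then show ?thesis
        using not_increasing_C_zero[of t] not_increasing_C_pos[of t] False by force
    qed
  qed
  moreover have "\<not> \<Phi>1 t < 0"
  proof (cases "0 < C")
    case True
    then show ?thesis using refl.not_increasing_C_neg[of "- t"] C by simp
  next
    case False
    show ?thesis
    proof (cases "1 < a")
      case True
      then show ?thesis using not_decreasing_a_gt_1[of t] False by simp
    next
      case a: False
      with assms have "a < 1" "1 \<le> m" by (auto simp: Suc_le_eq)
      then show ?thesis
        using refl.not_increasing_C_zero[of "- t"] refl.not_increasing_C_pos[of "- t"] False C by force
    qed
  qed
  ultimately show ?thesis by simp
qed

end

section \<open>Symmetric functions of a scalar plus a rank-one matrix\<close>

text \<open>Expanding \<open>v\<close> in the standard basis, every term but the \<open>r\<close>-th has two proportional rows.\<close>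

lemma det_one_row_replaced:
  fixes y :: "'a::comm_ring_1" and v :: "'a ^ 'n::finite"
  shows "det (\<chi> i. if i = r then v else y *s axis i 1) = v $ r * y ^ (CARD('n) - 1)"
proof -
  let ?M = "\<lambda>v. (\<chi> i. if i = r then v else y *s axis i 1) :: 'a ^ 'n ^ 'n"
  have basis: "det (?M (axis j 1)) = (if j = r then y ^ (CARD('n) - 1) else 0)" for j
  proof (cases "j = r")
    case True
    have "det (?M (axis j 1)) = (\<Prod>i\<in>UNIV. ?M (axis j 1) $ i $ i)"
      by (rule det_diagonal) (auto simp: True axis_def)
    also have "\<dots> = (\<Prod>i\<in>UNIV. if i = r then 1 else y)"
      by (intro prod.cong) (auto simp: True axis_def)
    also have "\<dots> = (\<Prod>i\<in>UNIV - {r}. y)"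
      by (intro prod.mono_neutral_cong_right) auto
    finally show ?thesis using True by simp
  next
    case False
    have "?M (axis j 1) = (\<chi> i. if i = j then y *s axis j 1 else ?M (axis j 1) $ i)"
      using False by (simp add: vec_eq_iff)
    then have "det (?M (axis j 1)) = det (\<chi> i. if i = j then y *s axis j 1 else ?M (axis j 1) $ i)"
      by simp
    also have "\<dots> = y * det (\<chi> i. if i = j then axis j 1 else ?M (axis j 1) $ i)"
      by (rule det_row_mul)
    also have "det (\<chi> i. if i = j then axis j 1 else ?M (axis j 1) $ i) = 0"
      using False by (intro det_identical_rows[of j r]) (auto simp: row_def vec_eq_iff)
    finally show ?thesis using False by simp
  qed
  have "v = (\<Sum>j\<in>UNIV. v $ j *s axis j 1)"
    by (simp add: vec_eq_iff axis_def if_distrib[of "\<lambda>x. _ * x"] cong: if_cong)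
  then have "det (?M v) = det (?M (\<Sum>j\<in>UNIV. v $ j *s axis j 1))"
    by (rule arg_cong[where f = "\<lambda>v. det (?M v)"])
  also have "\<dots> = (\<Sum>j\<in>UNIV. det (?M (v $ j *s axis j 1)))"
    by (rule det_linear_row_sum) simp
  also have "\<dots> = (\<Sum>j\<in>UNIV. v $ j * det (?M (axis j 1)))"
    by (intro sum.cong refl det_row_mul)
  also have "\<dots> = v $ r * y ^ (CARD('n) - 1)"
    unfolding basis by (simp add: if_distrib[of "\<lambda>x. _ * x"] cong: if_cong)
  finally show ?thesis .
qed

text \<open>The matrix determinant lemma over a commutative ring, as it is applied to polynomial entries and
  division by \<open>y\<close> is not possible. The set \<open>S\<close> of rows that carry the rank-one part makes it accessible
  to induction: splitting a new row \<open>r\<close> by linearity leaves a determinant with the row \<open>v\<close>, and this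
  row clears the rank-one part of all the others.\<close>

lemma det_scalar_plus_rank_one_on:
  fixes y :: "'a::comm_ring_1" and u v :: "'a ^ 'n::finite"
  assumes "finite S"
  shows "det (\<chi> i. y *s axis i 1 + (if i \<in> S then u $ i *s v else 0))
       = y ^ (CARD('n) - 1) * (y + (\<Sum>i\<in>S. u $ i * v $ i))"
  using assms
proof (induction S)
  case empty
  have "det ((\<chi> i. y *s axis i 1) :: 'a ^ 'n ^ 'n)
      = (\<Prod>i\<in>UNIV. ((\<chi> i. y *s axis i 1) :: 'a ^ 'n ^ 'n) $ i $ i)"
    by (rule det_diagonal) (auto simp: axis_def)
  also have "\<dots> = y ^ (CARD('n) - 1) * y"
    using power_minus_mult[of "CARD('n)" y] by (simp add: axis_def)
  finally show ?case by simp
next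
  case (insert r S)
  let ?R = "\<lambda>S i. y *s axis i 1 + (if i \<in> S then u $ i *s v else 0)"
  have clear: "det (\<chi> i. if i = r then v else ?R T i) = v $ r * y ^ (CARD('n) - 1)"
    if "finite T" "r \<notin> T" for T
    using that
  proof (induction T)
    case empty
    then show ?case using det_one_row_replaced[of r v y] by (simp cong: if_cong)
  next
    case (insert s T)
    let ?N = "(\<chi> i. if i = r then v else ?R T i) :: 'a ^ 'n ^ 'n"
    have "s \<noteq> r" using insert by auto
    have "(\<chi> i. if i = r then v else ?R (insert s T) i)
        = (\<chi> i. if i = s then row s ?N + u $ s *s row r ?N else row i ?N)"
      using insert by (auto simp: vec_eq_iff row_def)
    then have "det (\<chi> i. if i = r then v else ?R (insert s T) i)
        = det (\<chi> i. if i = s then row s ?N + u $ s *s row r ?N else row i ?N)"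
      by (rule arg_cong)
    also have "\<dots> = det ?N"
      by (rule det_row_operation[OF \<open>s \<noteq> r\<close>])
    also have "\<dots> = v $ r * y ^ (CARD('n) - 1)"
      using insert by blast
    finally show ?case .
  qed
  have "(\<chi> i. ?R (insert r S) i)
      = (\<chi> i. if i = r then y *s axis r 1 + u $ r *s v else ?R S i)"
    by (auto simp: vec_eq_iff)
  then have "det (\<chi> i. ?R (insert r S) i)
      = det (\<chi> i. if i = r then y *s axis r 1 + u $ r *s v else ?R S i)"
    by simp
  also have "\<dots> = det (\<chi> i. if i = r then y *s axis r 1 else ?R S i)
      + det (\<chi> i. if i = r then u $ r *s v else ?R S i)"
    by (rule det_row_add)
  also have "(\<chi> i. if i = r then y *s axis r 1 else ?R S i) = (\<chi> i. ?R S i)"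
    using insert(2) by (auto simp: vec_eq_iff)
  also have "det (\<chi> i. if i = r then u $ r *s v else ?R S i)
      = u $ r * det (\<chi> i. if i = r then v else ?R S i)"
    by (rule det_row_mul)
  also have "det (\<chi> i. if i = r then v else ?R S i) = v $ r * y ^ (CARD('n) - 1)"
    using insert by (intro clear) auto
  finally show ?case
    using insert by (simp add: algebra_simps)
qed

lemma eigenvalues_scalar_plus_rank_one:
  fixes u v :: "real ^ 'n::finite"
  shows "eigenvalues (\<chi> i j. (if i = j then d else 0) + u $ i * v $ j)
    = add_mset (complex_of_real (d + (\<Sum>i\<in>UNIV. u $ i * v $ i)))
        (replicate_mset (CARD('n) - 1) (complex_of_real d))"
proof -
  define y where "y = [:- complex_of_real d, 1:]"
  define U where "U = (\<chi> i. [:- complex_of_real (u $ i):])"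
  define V where "V = (\<chi> j. [:complex_of_real (v $ j):])"
  define s where "s = (\<Sum>i\<in>UNIV. u $ i * v $ i)"
  have "characteristic_poly (\<chi> i j. (if i = j then d else 0) + u $ i * v $ j)
      = det (\<chi> i. y *s axis i 1 + (if i \<in> UNIV then U $ i *s V else 0))"
    unfolding characteristic_poly_def
    by (rule arg_cong[where f = det]) (auto simp: vec_eq_iff axis_def y_def U_def V_def)
  also have "\<dots> = y ^ (CARD('n) - 1) * (y + (\<Sum>i\<in>UNIV. U $ i * V $ i))"
    by (rule det_scalar_plus_rank_one_on) simp
  also have "(\<Sum>i\<in>UNIV. U $ i * V $ i) = (\<Sum>i\<in>UNIV. [:- complex_of_real (u $ i * v $ i):])"
    by (simp add: U_def V_def mult.commute)
  also have "\<dots> = [:- complex_of_real s:]"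
    unfolding sum_to_poly by (simp add: s_def sum_negf)
  also have "y + [:- complex_of_real s:] = [:- complex_of_real (d + s), 1:]"
    by (simp add: y_def)
  finally have "characteristic_poly (\<chi> i j. (if i = j then d else 0) + u $ i * v $ j)
      = y ^ (CARD('n) - 1) * [:- complex_of_real (d + s), 1:]" .
  moreover have "y \<noteq> 0" "proots y = {#complex_of_real d#}"
    by (simp_all add: y_def)
  ultimately have "eigenvalues (\<chi> i j. (if i = j then d else 0) + u $ i * v $ j)
      = repeat_mset (CARD('n) - 1) {#complex_of_real d#} + {#complex_of_real (d + s)#}"
    unfolding eigenvalues_def by (simp only:) (subst proots_mult, auto simp: proots_power)
  then show ?thesis
    by (simp add: s_def)
qed

lemma finite_copies: "finite {(z, i). i < count X z}"
proof (rule finite_subset)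
  show "{(z, i). i < count X z} \<subseteq> (SIGMA z : set_mset X. {..<count X z})"
    by (auto simp flip: count_greater_zero_iff)
qed auto

lemma elem_sym_0 [simp]: "elem_sym 0 X = 1"
proof -
  have "S = {}" if "S \<subseteq> {(z, i). i < count X z}" "card S = 0" for S
    using finite_subset[OF that(1) finite_copies] that(2) by simp
  then have "{S. S \<subseteq> {(z, i). i < count X z} \<and> card S = 0} = {{}}"
    by auto
  then show ?thesis by (simp add: elem_sym_def)
qed

text \<open>The new copy of \<open>a\<close> has index \<open>count X a\<close>; the subsets of size \<open>k + 1\<close> are sorted by whether they
  contain it.\<close>

lemma elem_sym_add_mset:
  "elem_sym (Suc k) (add_mset a X) = elem_sym (Suc k) X + a * elem_sym k X"
proof -
  define A where "A = {(z, i). i < count X z}"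
  have fin: "finite A" unfolding A_def by (rule finite_copies)
  let ?p = "(a, count X a)"
  have new: "?p \<notin> A" by (simp add: A_def)
  have "{(z, i). i < count (add_mset a X) z} = insert ?p A"
    by (auto simp: A_def split: if_splits)
  then have "elem_sym (Suc k) (add_mset a X)
      = (\<Sum>S | S \<subseteq> insert ?p A \<and> card S = Suc k. \<Prod>q\<in>S. fst q)"
    by (simp add: elem_sym_def)
  also have "{S. S \<subseteq> insert ?p A \<and> card S = Suc k}
      = {S. S \<subseteq> A \<and> card S = Suc k} \<union> insert ?p ` {S. S \<subseteq> A \<and> card S = k}" (is "?L = ?R1 \<union> ?R2")
  proof (intro equalityI subsetI)
    fix S assume S: "S \<in> ?L"
    show "S \<in> ?R1 \<union> ?R2"
    proof (cases "?p \<in> S")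
      case True
      then have "S = insert ?p (S - {?p})" "card (S - {?p}) = k"
        using S finite_subset[of S "insert ?p A"] fin by auto
      moreover have "S - {?p} \<subseteq> A" using S by auto
      ultimately show ?thesis by blast
    next
      case False
      then show ?thesis using S by auto
    qed
  next
    fix S assume "S \<in> ?R1 \<union> ?R2"
    then show "S \<in> ?L"
      using new finite_subset[OF _ fin] by (auto simp: card_insert_if)
  qed
  also have "(\<Sum>S\<in>?R1 \<union> ?R2. \<Prod>q\<in>S. fst q)
      = (\<Sum>S\<in>?R1. \<Prod>q\<in>S. fst q) + (\<Sum>S\<in>?R2. \<Prod>q\<in>S. fst q)"
    using fin new by (intro sum.union_disjoint) auto
  also have "(\<Sum>S\<in>?R2. \<Prod>q\<in>S. fst q) = (\<Sum>S | S \<subseteq> A \<and> card S = k. \<Prod>q\<in>insert ?p S. fst q)"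
    using new by (intro sum.reindex[unfolded o_def] inj_onI)
      (metis (no_types, lifting) Diff_insert_absorb mem_Collect_eq subsetD)
  also have "\<dots> = (\<Sum>S | S \<subseteq> A \<and> card S = k. a * (\<Prod>q\<in>S. fst q))"
  proof (intro sum.cong refl)
    fix S assume "S \<in> {S. S \<subseteq> A \<and> card S = k}"
    then have "finite S" "?p \<notin> S" using fin new finite_subset by auto
    then show "prod fst (insert ?p S) = a * prod fst S" by simp
  qed
  finally show ?thesis
    by (simp add: elem_sym_def A_def sum_distrib_left)
qed

lemma elem_sym_empty_Suc [simp]: "elem_sym (Suc k) {#} = 0"
  by (simp add: elem_sym_def)

lemma elem_sym_replicate: "elem_sym k (replicate_mset n x) = of_nat (n choose k) * x ^ k"
proof (induction n arbitrary: k)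
  case 0
  then show ?case by (cases k) auto
next
  case (Suc n)
  then show ?case by (cases k) (auto simp: elem_sym_add_mset algebra_simps)
qed

text \<open>The eigenvalues are \<open>d\<close>, \<open>n - 1\<close> times, and \<open>d + s\<close> with \<open>s = u \<bullet> v\<close>. The pure \<open>d\<close> terms combine by
  Pascal's rule to \<open>(n choose k) = (n / k) (n - 1 choose k - 1)\<close>, which is where the constant
  \<open>a = n / (2 k)\<close> of the profile equation comes from.\<close>

lemma sigma_k_scalar_plus_rank_one:
  fixes u v :: "real ^ 'n::finite"
  assumes "1 \<le> k" "k \<le> CARD('n)"
  shows "sigma_k k (\<chi> i j. (if i = j then d else 0) + u $ i * v $ j)
    = real ((CARD('n) - 1) choose (k - 1)) * d ^ (k - 1)
        * (real CARD('n) / real k * d + (\<Sum>i\<in>UNIV. u $ i * v $ i))"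
proof -
  obtain m where m: "k = Suc m" using assms(1) by (cases k) auto
  obtain N where N: "CARD('n) = Suc N" using assms by (cases "CARD('n)") auto
  define s where "s = (\<Sum>i\<in>UNIV. u $ i * v $ i)"
  have "sigma_k k (\<chi> i j. (if i = j then d else 0) + u $ i * v $ j)
      = Re (complex_of_real (real (N choose Suc m) * d ^ Suc m + (d + s) * (real (N choose m) * d ^ m)))"
    unfolding sigma_k_def eigenvalues_scalar_plus_rank_one s_def[symmetric] m elem_sym_add_mset elem_sym_replicate N
    by simp
  also have "\<dots> = (real (N choose Suc m) + real (N choose m)) * d ^ Suc m + s * real (N choose m) * d ^ m"
    unfolding Re_complex_of_real by (simp add: algebra_simps)
  also have "real (N choose Suc m) + real (N choose m) = real (Suc N) / real (Suc m) * real (N choose m)"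
    using Suc_times_binomial_eq[of N m] by (simp add: field_simps flip: of_nat_mult of_nat_add)
  finally show ?thesis
    by (simp add: m N s_def algebra_simps)
qed

section \<open>Functions of a linear form\<close>

lemma partial_along_xi:
  assumes "(H has_real_derivative D) (at (xi \<alpha> x))"
  shows "partial i (\<lambda>y. H (xi \<alpha> y)) x = D * \<alpha> $ i"
proof -
  have xi: "xi \<alpha> = (\<bullet>) \<alpha>"
    by (simp add: fun_eq_iff xi_def inner_vec_def)
  have "((\<lambda>y. H (xi \<alpha> y)) has_derivative (\<lambda>h. D * (\<alpha> \<bullet> h))) (at x)"
    using has_derivative_compose[of "xi \<alpha>" "(\<bullet>) \<alpha>" x UNIV H "(*) D"] assms
    unfolding has_field_derivative_def xi
    by (auto intro: bounded_linear_imp_has_derivative bounded_linear_inner_right)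
  then have "frechet_derivative (\<lambda>y. H (xi \<alpha> y)) (at x) = (\<lambda>h. D * (\<alpha> \<bullet> h))"
    by (rule frechet_derivative_at[symmetric])
  then show ?thesis by (simp add: partial_def inner_axis)
qed

lemma xi_surj:
  fixes \<alpha> :: "real ^ 'n::finite"
  assumes "\<alpha> \<noteq> 0"
  shows "xi \<alpha> (t *\<^sub>R ((1 / (\<alpha> \<bullet> \<alpha>)) *\<^sub>R \<alpha>)) = t"
proof -
  have "xi \<alpha> y = \<alpha> \<bullet> y" for y by (simp add: xi_def inner_vec_def)
  then show ?thesis using assms by simp
qed

text \<open>The profile inherits differentiability by restriction to the line spanned by \<open>\<alpha>\<close>, on which \<open>\<xi>\<close> is
  a coordinate.\<close>

lemma differentiable_profile:
  fixes \<alpha> :: "real ^ 'n::finite"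
  assumes "\<alpha> \<noteq> 0" and "\<And>x. (\<lambda>y. H (xi \<alpha> y)) differentiable (at x)"
  shows "(H has_real_derivative deriv H t) (at t)"
proof -
  define e where "e = (1 / (\<alpha> \<bullet> \<alpha>)) *\<^sub>R \<alpha>"
  have "xi \<alpha> (s *\<^sub>R e) = s" for s
    unfolding e_def by (rule xi_surj[OF assms(1)])
  then have "H = (\<lambda>y. H (xi \<alpha> y)) \<circ> (\<lambda>s. s *\<^sub>R e)" by auto
  moreover have "(\<lambda>s. s *\<^sub>R e) differentiable (at t)" by simp
  ultimately have "H differentiable (at t)"
    using differentiable_chain_at assms(2) by metis
  then show ?thesis
    by (simp add: DERIV_deriv_iff_real_differentiable)
qed

text \<open>A partial derivative in a direction with \<open>\<alpha>\<^sub>i \<noteq> 0\<close> is \<open>\<alpha>\<^sub>i\<close> times the derivative of the profile,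
  and it is again a differentiable function of \<open>\<xi>\<close>, so the argument can be repeated.\<close>

lemma smooth_profile:
  fixes \<alpha> :: "real ^ 'n::finite"
  assumes "\<alpha> \<noteq> 0" "smooth (\<lambda>y. H (xi \<alpha> y))"
  shows "(H has_real_derivative deriv H t) (at t)"
    and "(deriv H has_real_derivative deriv (deriv H) t) (at t)"
proof -
  let ?h = "\<lambda>y. H (xi \<alpha> y)"
  have Ck: "Ck (Suc (Suc 0)) ?h" using assms(2) by (simp add: smooth_def)
  then have H: "(H has_real_derivative deriv H t) (at t)" for t
    by (intro differentiable_profile[OF assms(1)]) auto
  then show "(H has_real_derivative deriv H t) (at t)" .
  obtain i where i: "\<alpha> $ i \<noteq> 0" using assms(1) by (auto simp: vec_eq_iff)
  have "partial i ?h differentiable (at x)" for x using Ck by auto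
  also have "partial i ?h = (\<lambda>y. deriv H (xi \<alpha> y) * \<alpha> $ i)"
    using partial_along_xi[OF H] by auto
  finally have *: "(\<lambda>y. deriv H (xi \<alpha> y) * \<alpha> $ i) differentiable (at x)" for x .
  have "(\<lambda>y. deriv H (xi \<alpha> y)) differentiable (at x)" for x
    using differentiable_mult[OF *[of x] differentiable_const[of "inverse (\<alpha> $ i)" "at x"]] i
    by simp
  then show "(deriv H has_real_derivative deriv (deriv H) t) (at t)"
    by (rule differentiable_profile[OF assms(1)])
qed

section \<open>Curvature of a conformally flat metric with invariant factor\<close>

definition kronecker :: "'n \<Rightarrow> 'n \<Rightarrow> real" where
  "kronecker i j = (if i = j then 1 else 0)"

lemma sum_kronecker: "(\<Sum>l\<in>UNIV. kronecker l m * X l) = X m" "(\<Sum>l\<in>UNIV. kronecker m l * X l) = X m"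
   "(\<Sum>l\<in>UNIV. X l * kronecker l m) = X m" "(\<Sum>l\<in>UNIV. X l * kronecker m l) = X m"
  for m :: "'n::finite"
  by (simp_all add: kronecker_def if_distrib[of "\<lambda>z. z * _"] if_distrib[of "\<lambda>z. _ * z"] cong: if_cong)

lemma matrix_inv_unique:
  assumes "A ** B = mat 1" "B ** A = mat 1"
  shows "matrix_inv A = B"
proof -
  have "A ** matrix_inv A = mat 1 \<and> matrix_inv A ** A = mat 1"
    unfolding matrix_inv_def by (rule someI[of _ B]) (use assms in simp)
  then show ?thesis
    using assms by (metis matrix_mul_assoc matrix_mul_lid matrix_mul_rid)
qed

text \<open>An off-diagonal entry kills \<open>p\<close> as soon as two components of \<open>\<alpha>\<close> are nonzero; otherwise a diagonal
  entry with \<open>\<alpha>\<^sub>j = 0\<close> kills \<open>q\<close> first.\<close>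

lemma rank_one_eq_diagonal_imp_zero:
  fixes \<alpha> :: "real ^ 'n::finite"
  assumes "2 \<le> CARD('n)" "\<alpha> \<noteq> 0" "\<And>i. \<epsilon> i \<noteq> 0"
    and eq: "\<And>i j. p * (\<alpha> $ i * \<alpha> $ j) = q * (\<epsilon> i * kronecker i j)"
  shows "p = 0" "q = 0"
proof -
  obtain i where i: "\<alpha> $ i \<noteq> 0" using assms(2) by (auto simp: vec_eq_iff)
  have "\<exists>j. j \<noteq> i"
  proof (rule ccontr)
    assume "\<not> (\<exists>j. j \<noteq> i)"
    then have "(UNIV :: 'n set) = {i}" by auto
    then have "CARD('n) = card {i}" by simp
    then show False using assms(1) by simp
  qed
  then obtain j where "j \<noteq> i" ..
  then show "p = 0" using eq[of i j] eq[of j j] eq[of i i] i assms(3)[of j] by (auto simp: kronecker_def)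
  then show "q = 0" using eq[of i i] assms(3)[of i] by (auto simp: kronecker_def)
qed

locale conformal_profile =
  fixes \<epsilon> :: "'n::finite \<Rightarrow> real" and \<alpha> :: "real ^ 'n" and \<phi> :: "real ^ 'n \<Rightarrow> real"
    and \<Phi> \<Phi>1 \<Phi>2 :: "real \<Rightarrow> real"
  assumes \<epsilon>_sq: "\<epsilon> i * \<epsilon> i = 1"
    and \<phi>: "\<phi> x = \<Phi> (xi \<alpha> x)"
    and \<Phi>_pos: "0 < \<Phi> t"
    and \<Phi>_D1: "(\<Phi> has_real_derivative \<Phi>1 t) (at t)"
    and \<Phi>_D2: "(\<Phi>1 has_real_derivative \<Phi>2 t) (at t)"
begin

abbreviation g :: "real ^ 'n \<Rightarrow> real ^ 'n ^ 'n" where "g \<equiv> conformal_metric \<epsilon> \<phi>"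

definition N :: real where "N = (\<Sum>i\<in>UNIV. \<epsilon> i * (\<alpha> $ i)\<^sup>2)"

text \<open>The metric enters its own curvature through the logarithmic derivative \<open>v\<close> of \<open>\<Phi>\<close> only.\<close>

definition v :: "real \<Rightarrow> real" where "v t = \<Phi>1 t / \<Phi> t"

definition v' :: "real \<Rightarrow> real" where "v' t = \<Phi>2 t / \<Phi> t - (v t)\<^sup>2"

lemma v_deriv: "(v has_real_derivative v' t) (at t)"
proof -
  have "((\<lambda>t. \<Phi>1 t / \<Phi> t) has_real_derivative v' t) (at t)"
    by (rule DERIV_cong[OF DERIV_divide[OF \<Phi>_D2 \<Phi>_D1]])
       (use \<Phi>_pos[of t] in \<open>auto simp: v'_def v_def field_simps power2_eq_square\<close>)
  then show ?thesis by (simp add: v_def[abs_def])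
qed

lemma metric_entry: "g x $ i $ j = 1 / (\<Phi> (xi \<alpha> x))\<^sup>2 * (\<epsilon> i * kronecker i j)"
  by (simp add: conformal_metric_def pseudo_Euclidean_def \<phi> kronecker_def)

lemma matrix_inv_metric:
  "matrix_inv (g x) = (\<chi> i j. (\<Phi> (xi \<alpha> x))\<^sup>2 * (\<epsilon> i * kronecker i j))" (is "_ = ?I")
proof (rule matrix_inv_unique)
  have mult: "(p * (\<epsilon> i * kronecker i l)) * (q * (\<epsilon> l * kronecker l j)) = kronecker i l * (p * q * kronecker i j)" for p q i l j
    using \<epsilon>_sq[of i] by (auto simp: kronecker_def)
  have nz: "\<Phi> (xi \<alpha> x) \<noteq> 0" using \<Phi>_pos[of "xi \<alpha> x"] by simp
  have "(g x ** ?I) $ i $ j = 1 / (\<Phi> (xi \<alpha> x))\<^sup>2 * (\<Phi> (xi \<alpha> x))\<^sup>2 * kronecker i j" for i j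
    by (simp only: matrix_matrix_mult_def vec_lambda_beta metric_entry mult sum_kronecker)
  then show "g x ** ?I = mat 1"
    using nz by (simp add: vec_eq_iff mat_def kronecker_def)
  have "(?I ** g x) $ i $ j = (\<Phi> (xi \<alpha> x))\<^sup>2 * (1 / (\<Phi> (xi \<alpha> x))\<^sup>2) * kronecker i j" for i j
    by (simp only: matrix_matrix_mult_def vec_lambda_beta metric_entry mult sum_kronecker)
  then show "?I ** g x = mat 1"
    using nz by (simp add: vec_eq_iff mat_def kronecker_def)
qed

text \<open>The Christoffel symbols of the metric are \<open>- v\<close> times this constant array (lemma \<open>christoffel\<close>), so
  the Ricci tensor reduces to contractions of \<open>\<Gamma>\<close> with \<open>\<alpha>\<close> and with itself.\<close>

definition \<Gamma> :: "'n \<Rightarrow> 'n \<Rightarrow> 'n \<Rightarrow> real" where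
  "\<Gamma> m i j = kronecker j m * \<alpha> $ i + kronecker i m * \<alpha> $ j - \<epsilon> m * \<epsilon> i * kronecker i j * \<alpha> $ m"

lemma partial_metric:
  "partial l (\<lambda>y. g y $ i $ j) x
    = - 2 * v (xi \<alpha> x) / (\<Phi> (xi \<alpha> x))\<^sup>2 * (\<epsilon> i * kronecker i j) * \<alpha> $ l"
proof -
  have "((\<lambda>t. 1 / (\<Phi> t)\<^sup>2 * (\<epsilon> i * kronecker i j)) has_real_derivative
      - 2 * v t / (\<Phi> t)\<^sup>2 * (\<epsilon> i * kronecker i j)) (at t)" for t
    using \<Phi>_pos[of t]
    by (auto intro!: derivative_eq_intros \<Phi>_D1 simp: v_def field_simps power2_eq_square)
  from partial_along_xi[OF this] show ?thesis
    unfolding metric_entry .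
qed

lemma christoffel: "christoffel g m i j x = - v (xi \<alpha> x) * \<Gamma> m i j"
proof -
  let ?\<Phi> = "\<Phi> (xi \<alpha> x)" and ?v = "v (xi \<alpha> x)"
  have nz: "?\<Phi> \<noteq> 0" using \<Phi>_pos[of "xi \<alpha> x"] by simp
  have "christoffel g m i j x
      = (\<Sum>l\<in>UNIV. kronecker m l * (- ?v * (\<epsilon> m * (\<epsilon> j * kronecker j l * \<alpha> $ i + \<epsilon> i * kronecker i l * \<alpha> $ j
          - \<epsilon> i * kronecker i j * \<alpha> $ l)) * 2)) / 2"
    unfolding christoffel_def partial_metric matrix_inv_metric
    using nz by (intro arg_cong[where f = "\<lambda>s. s / 2"] sum.cong) (auto simp: field_simps)
  also have "\<dots> = - ?v * (\<epsilon> m * (\<epsilon> j * kronecker j m * \<alpha> $ i + \<epsilon> i * kronecker i m * \<alpha> $ j - \<epsilon> i * kronecker i j * \<alpha> $ m))"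
    unfolding sum_kronecker by simp
  also have "\<epsilon> m * (\<epsilon> j * kronecker j m * \<alpha> $ i + \<epsilon> i * kronecker i m * \<alpha> $ j - \<epsilon> i * kronecker i j * \<alpha> $ m) = \<Gamma> m i j"
    using \<epsilon>_sq[of m] by (auto simp: \<Gamma>_def kronecker_def algebra_simps)
  finally show ?thesis .
qed

lemma partial_christoffel:
  "partial l (christoffel g m i j) x = - v' (xi \<alpha> x) * \<Gamma> m i j * \<alpha> $ l"
proof -
  have "((\<lambda>t. - v t * \<Gamma> m i j) has_real_derivative - v' t * \<Gamma> m i j) (at t)" for t
    by (auto intro!: derivative_eq_intros v_deriv)
  then have "partial l (\<lambda>y. - v (xi \<alpha> y) * \<Gamma> m i j) x = - v' (xi \<alpha> x) * \<Gamma> m i j * \<alpha> $ l"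
    by (rule partial_along_xi)
  moreover have "christoffel g m i j = (\<lambda>y. - v (xi \<alpha> y) * \<Gamma> m i j)"
    by (rule ext) (rule christoffel)
  ultimately show ?thesis by simp
qed

lemma \<Gamma>_contract_upper: "(\<Sum>m\<in>UNIV. \<Gamma> m i j * \<alpha> $ m) = 2 * \<alpha> $ i * \<alpha> $ j - N * (\<epsilon> i * kronecker i j)"
proof -
  have "(\<Sum>m\<in>UNIV. \<Gamma> m i j * \<alpha> $ m)
      = (\<Sum>m\<in>UNIV. kronecker j m * (\<alpha> $ i * \<alpha> $ m) + kronecker i m * (\<alpha> $ j * \<alpha> $ m)
          - \<epsilon> m * (\<alpha> $ m)\<^sup>2 * (\<epsilon> i * kronecker i j))"
    by (intro sum.cong) (auto simp: \<Gamma>_def power2_eq_square algebra_simps)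
  also have "\<dots> = 2 * \<alpha> $ i * \<alpha> $ j - N * (\<epsilon> i * kronecker i j)"
    unfolding sum_subtractf sum.distrib sum_kronecker N_def sum_distrib_right[symmetric] by simp
  finally show ?thesis .
qed

lemma \<Gamma>_trace: "(\<Sum>m\<in>UNIV. \<Gamma> m i m) = real CARD('n) * \<alpha> $ i"
  "(\<Sum>m\<in>UNIV. \<Gamma> m m i) = real CARD('n) * \<alpha> $ i"
proof -
  have "(\<Sum>m\<in>UNIV. \<Gamma> m i m) = (\<Sum>m\<in>UNIV. \<alpha> $ i + kronecker i m * \<alpha> $ m - kronecker i m * (\<epsilon> i * \<epsilon> i * \<alpha> $ m))"
    by (intro sum.cong) (auto simp: \<Gamma>_def kronecker_def)
  then show 1: "(\<Sum>m\<in>UNIV. \<Gamma> m i m) = real CARD('n) * \<alpha> $ i"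
    unfolding sum_subtractf sum.distrib sum_kronecker \<epsilon>_sq by simp
  have "\<Gamma> m m i = \<Gamma> m i m" for m
    by (simp add: \<Gamma>_def kronecker_def)
  then show "(\<Sum>m\<in>UNIV. \<Gamma> m m i) = real CARD('n) * \<alpha> $ i" using 1 by simp
qed

lemma \<Gamma>_product_first: "(\<Sum>m\<in>UNIV. \<Sum>l\<in>UNIV. \<Gamma> m m l * \<Gamma> l i j)
    = real CARD('n) * (2 * \<alpha> $ i * \<alpha> $ j - N * (\<epsilon> i * kronecker i j))"
proof -
  have "(\<Sum>m\<in>UNIV. \<Sum>l\<in>UNIV. \<Gamma> m m l * \<Gamma> l i j) = (\<Sum>l\<in>UNIV. (\<Sum>m\<in>UNIV. \<Gamma> m m l) * \<Gamma> l i j)"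
    unfolding sum_distrib_right by (rule sum.swap)
  also have "\<dots> = real CARD('n) * (\<Sum>l\<in>UNIV. \<Gamma> l i j * \<alpha> $ l)"
    unfolding \<Gamma>_trace sum_distrib_left by (intro sum.cong) auto
  finally show ?thesis unfolding \<Gamma>_contract_upper .
qed

lemma \<Gamma>_product_second: "(\<Sum>m\<in>UNIV. \<Sum>l\<in>UNIV. \<Gamma> m j l * \<Gamma> l i m)
    = (real CARD('n) + 2) * (\<alpha> $ i * \<alpha> $ j) - 2 * N * (\<epsilon> i * kronecker i j)"
proof -
  have inner: "(\<Sum>l\<in>UNIV. \<Gamma> m j l * \<Gamma> l i m)
      = \<alpha> $ j * \<Gamma> m i m + kronecker j m * (2 * \<alpha> $ i * \<alpha> $ m - N * (\<epsilon> i * kronecker i m))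
        - \<epsilon> j * (\<epsilon> m * \<alpha> $ m * \<Gamma> j i m)" for m
  proof -
    have "(\<Sum>l\<in>UNIV. \<Gamma> m j l * \<Gamma> l i m)
        = (\<Sum>l\<in>UNIV. kronecker l m * (\<alpha> $ j * \<Gamma> l i m) + kronecker j m * (\<Gamma> l i m * \<alpha> $ l)
            - kronecker j l * (\<epsilon> j * (\<epsilon> m * \<alpha> $ m * \<Gamma> l i m)))"
      by (intro sum.cong) (auto simp: \<Gamma>_def[of m] algebra_simps)
    then show ?thesis
      unfolding sum_subtractf sum.distrib sum_kronecker sum_distrib_left[symmetric] \<Gamma>_contract_upper .
  qed
  have "(\<Sum>m\<in>UNIV. \<epsilon> m * \<alpha> $ m * \<Gamma> j i m)
      = (\<Sum>m\<in>UNIV. kronecker m j * (\<epsilon> m * \<alpha> $ m * \<alpha> $ i) + \<epsilon> m * (\<alpha> $ m)\<^sup>2 * kronecker i j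
          - kronecker i m * (\<epsilon> j * (\<epsilon> i * \<epsilon> m) * \<alpha> $ m * \<alpha> $ j))"
    by (intro sum.cong) (auto simp: \<Gamma>_def power2_eq_square algebra_simps)
  also have "\<dots> = N * kronecker i j"
    unfolding sum_subtractf sum.distrib sum_kronecker sum_distrib_right[symmetric] N_def[symmetric] \<epsilon>_sq
    by simp
  finally have outer: "(\<Sum>m\<in>UNIV. \<epsilon> m * \<alpha> $ m * \<Gamma> j i m) = N * kronecker i j" .
  have "(\<Sum>m\<in>UNIV. \<Sum>l\<in>UNIV. \<Gamma> m j l * \<Gamma> l i m)
      = \<alpha> $ j * (real CARD('n) * \<alpha> $ i) + (2 * \<alpha> $ i * \<alpha> $ j - N * (\<epsilon> i * kronecker i j)) - \<epsilon> j * (N * kronecker i j)"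
    unfolding inner sum_subtractf sum.distrib sum_distrib_left[symmetric] outer sum_kronecker \<Gamma>_trace ..
  also have "\<epsilon> j * (N * kronecker i j) = N * (\<epsilon> i * kronecker i j)"
    by (simp add: kronecker_def)
  finally show ?thesis by (simp add: algebra_simps)
qed

lemma ricci:
  "ricci g x $ i $ j =
     (real CARD('n) - 2) * (v' (xi \<alpha> x) + (v (xi \<alpha> x))\<^sup>2) * (\<alpha> $ i * \<alpha> $ j)
     + N * (v' (xi \<alpha> x) - (real CARD('n) - 2) * (v (xi \<alpha> x))\<^sup>2) * (\<epsilon> i * kronecker i j)"
proof -
  let ?v = "v (xi \<alpha> x)" and ?v' = "v' (xi \<alpha> x)"
  have "ricci g x $ i $ j
      = (\<Sum>m\<in>UNIV. - ?v' * (\<Gamma> m i j * \<alpha> $ m) + ?v' * \<alpha> $ j * \<Gamma> m i m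
          + (\<Sum>l\<in>UNIV. ?v\<^sup>2 * (\<Gamma> m m l * \<Gamma> l i j) - ?v\<^sup>2 * (\<Gamma> m j l * \<Gamma> l i m)))"
    unfolding ricci_def partial_christoffel christoffel
    by (simp add: power2_eq_square algebra_simps)
  also have "\<dots> = - ?v' * (2 * \<alpha> $ i * \<alpha> $ j - N * (\<epsilon> i * kronecker i j)) + ?v' * \<alpha> $ j * (real CARD('n) * \<alpha> $ i)
      + (?v\<^sup>2 * (real CARD('n) * (2 * \<alpha> $ i * \<alpha> $ j - N * (\<epsilon> i * kronecker i j)))
         - ?v\<^sup>2 * ((real CARD('n) + 2) * (\<alpha> $ i * \<alpha> $ j) - 2 * N * (\<epsilon> i * kronecker i j)))"
    unfolding sum.distrib sum_subtractf sum_distrib_left[symmetric]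
      \<Gamma>_contract_upper \<Gamma>_trace \<Gamma>_product_first \<Gamma>_product_second ..
  finally show ?thesis by (simp add: algebra_simps)
qed

lemma scalar_curvature:
  "scalar_curvature g x = (\<Phi> (xi \<alpha> x))\<^sup>2 * (real CARD('n) - 1) * N *
     (2 * v' (xi \<alpha> x) - (real CARD('n) - 2) * (v (xi \<alpha> x))\<^sup>2)"
proof -
  let ?v = "v (xi \<alpha> x)" and ?v' = "v' (xi \<alpha> x)" and ?\<Phi> = "\<Phi> (xi \<alpha> x)"
  define P where "P = (real CARD('n) - 2) * (?v' + ?v\<^sup>2)"
  define Q where "Q = N * (?v' - (real CARD('n) - 2) * ?v\<^sup>2)"
  have "scalar_curvature g x
      = (\<Sum>i\<in>UNIV. \<Sum>j\<in>UNIV. kronecker i j * (?\<Phi>\<^sup>2 * \<epsilon> i * (P * (\<alpha> $ i * \<alpha> $ j) + Q * (\<epsilon> i * kronecker i j))))"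
    unfolding scalar_curvature_def ricci matrix_inv_metric P_def Q_def
    by (intro sum.cong) (auto simp: mult_ac)
  also have "\<dots> = (\<Sum>i\<in>UNIV. ?\<Phi>\<^sup>2 * P * (\<epsilon> i * (\<alpha> $ i)\<^sup>2) + ?\<Phi>\<^sup>2 * Q)"
    unfolding sum_kronecker using \<epsilon>_sq
    by (intro sum.cong) (auto simp: kronecker_def power2_eq_square algebra_simps)
  also have "\<dots> = ?\<Phi>\<^sup>2 * P * N + real CARD('n) * (?\<Phi>\<^sup>2 * Q)"
    unfolding sum.distrib sum_distrib_left[symmetric] N_def by simp
  finally show ?thesis unfolding P_def Q_def by (simp add: algebra_simps)
qed

lemma schouten:
  assumes "CARD('n) \<noteq> 2" "2 \<le> CARD('n)"
  shows "schouten g x $ i $ j = (v' (xi \<alpha> x) + (v (xi \<alpha> x))\<^sup>2) * (\<alpha> $ i * \<alpha> $ j)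
     - N * (v (xi \<alpha> x))\<^sup>2 / 2 * (\<epsilon> i * kronecker i j)"
proof -
  have n: "real CARD('n) - 2 \<noteq> 0" "real CARD('n) - 1 \<noteq> 0" "\<Phi> (xi \<alpha> x) \<noteq> 0"
    using assms \<Phi>_pos[of "xi \<alpha> x"] by auto
  have s: "scalar_curvature g x / (2 * (real CARD('n) - 1)) * (1 / (\<Phi> (xi \<alpha> x))\<^sup>2 * (\<epsilon> i * kronecker i j))
     = N * (v' (xi \<alpha> x) - (real CARD('n) - 2) * (v (xi \<alpha> x))\<^sup>2 / 2) * (\<epsilon> i * kronecker i j)"
  proof -
    have "scalar_curvature g x = (2 * (real CARD('n) - 1)) * (\<Phi> (xi \<alpha> x))\<^sup>2
        * (N * (v' (xi \<alpha> x) - (real CARD('n) - 2) * (v (xi \<alpha> x))\<^sup>2 / 2))"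
      unfolding scalar_curvature by (simp add: field_simps)
    then show ?thesis using n by simp
  qed
  have "schouten g x $ i $ j = 1 / (real CARD('n) - 2) * ((real CARD('n) - 2) *
     ((v' (xi \<alpha> x) + (v (xi \<alpha> x))\<^sup>2) * (\<alpha> $ i * \<alpha> $ j) - N * (v (xi \<alpha> x))\<^sup>2 / 2 * (\<epsilon> i * kronecker i j)))"
    unfolding schouten_def vector_scaleR_component vector_minus_component ricci metric_entry
      real_scaleR_def s by (simp add: algebra_simps)
  then show ?thesis using n(1) by simp
qed

lemma partial_profile: "partial i \<phi> = (\<lambda>x. \<Phi>1 (xi \<alpha> x) * \<alpha> $ i)"
proof -
  have "\<phi> = (\<lambda>y. \<Phi> (xi \<alpha> y))" using \<phi> by auto
  then show ?thesis using partial_along_xi[OF \<Phi>_D1] by auto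
qed

text \<open>Since \<open>v' + v\<^sup>2 = \<Phi>'' / \<Phi>\<close>, the curvature formula in dimension at least 3 and the convention in
  dimension 2 give the same expression.\<close>

lemma conformal_schouten:
  assumes "2 \<le> CARD('n)"
  shows "conformal_schouten \<epsilon> \<phi> x $ i $ j = \<Phi>2 (xi \<alpha> x) / \<Phi> (xi \<alpha> x) * (\<alpha> $ i * \<alpha> $ j)
     - N * (v (xi \<alpha> x))\<^sup>2 / 2 * (\<epsilon> i * kronecker i j)"
proof (cases "CARD('n) = 2")
  case True
  have "((\<lambda>t. \<Phi>1 t * \<alpha> $ j) has_real_derivative \<Phi>2 t * \<alpha> $ j) (at t)" for t
    by (auto intro!: derivative_eq_intros \<Phi>_D2)
  then have P: "partial i (partial j \<phi>) x = \<Phi>2 (xi \<alpha> x) * \<alpha> $ j * \<alpha> $ i"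
    unfolding partial_profile by (rule partial_along_xi)
  have "(\<Sum>i\<in>UNIV. \<epsilon> i * (partial i \<phi> x)\<^sup>2) = (\<Phi>1 (xi \<alpha> x))\<^sup>2 * N"
    unfolding partial_profile N_def sum_distrib_left
    by (intro sum.cong) (auto simp: power_mult_distrib)
  with True P show ?thesis
    by (simp add: conformal_schouten_def pseudo_Euclidean_def \<phi> v_def kronecker_def power_divide mult_ac)
next
  case False
  then show ?thesis
    using schouten[of x i j] assms by (simp add: conformal_schouten_def v'_def)
qed

lemma sigma_k_soliton:
  assumes "2 \<le> CARD('n)" "1 \<le> k" "k \<le> CARD('n)"
  shows "sigma_k k (matrix_inv (g x) ** conformal_schouten \<epsilon> \<phi> x)
    = real ((CARD('n) - 1) choose (k - 1)) * (- N / 2) ^ (k - 1) * N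
      * (\<Phi>1 (xi \<alpha> x) ^ (2 * (k - 1)) * (\<Phi> (xi \<alpha> x) * \<Phi>2 (xi \<alpha> x)
          - real CARD('n) / (2 * real k) * (\<Phi>1 (xi \<alpha> x))\<^sup>2))"
proof -
  let ?\<Phi> = "\<Phi> (xi \<alpha> x)" and ?\<Phi>1 = "\<Phi>1 (xi \<alpha> x)" and ?\<Phi>2 = "\<Phi>2 (xi \<alpha> x)"
  have nz: "?\<Phi> \<noteq> 0" using \<Phi>_pos[of "xi \<alpha> x"] by simp
  define u :: "real ^ 'n" where "u = (\<chi> i. ?\<Phi> * ?\<Phi>2 * (\<epsilon> i * \<alpha> $ i))"
  have "matrix_inv (g x) ** conformal_schouten \<epsilon> \<phi> x
      = (\<chi> i j. (if i = j then - N / 2 * ?\<Phi>1\<^sup>2 else 0) + u $ i * \<alpha> $ j)"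
  proof -
    have "(matrix_inv (g x) ** conformal_schouten \<epsilon> \<phi> x) $ i $ j
        = (if i = j then - N / 2 * ?\<Phi>1\<^sup>2 else 0) + u $ i * \<alpha> $ j" for i j
    proof -
      have "(matrix_inv (g x) ** conformal_schouten \<epsilon> \<phi> x) $ i $ j
          = (\<Sum>l\<in>UNIV. kronecker i l * (?\<Phi>\<^sup>2 * \<epsilon> i * conformal_schouten \<epsilon> \<phi> x $ l $ j))"
        by (simp add: matrix_matrix_mult_def matrix_inv_metric mult_ac)
      also have "\<dots> = ?\<Phi>\<^sup>2 * \<epsilon> i * (?\<Phi>2 / ?\<Phi> * (\<alpha> $ i * \<alpha> $ j))
          - ?\<Phi>\<^sup>2 * (\<epsilon> i * \<epsilon> i) * (N * (v (xi \<alpha> x))\<^sup>2 / 2 * kronecker i j)"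
        unfolding sum_kronecker conformal_schouten[OF assms(1)] by (simp add: algebra_simps)
      also have "\<dots> = (if i = j then - N / 2 * ?\<Phi>1\<^sup>2 else 0) + u $ i * \<alpha> $ j"
        unfolding \<epsilon>_sq using nz by (simp add: kronecker_def u_def v_def power2_eq_square)
      finally show ?thesis .
    qed
    then show ?thesis by (simp add: vec_eq_iff)
  qed
  moreover have "(\<Sum>i\<in>UNIV. u $ i * \<alpha> $ i) = ?\<Phi> * ?\<Phi>2 * N"
    unfolding N_def sum_distrib_left by (intro sum.cong) (auto simp: u_def power2_eq_square)
  ultimately have "sigma_k k (matrix_inv (g x) ** conformal_schouten \<epsilon> \<phi> x)
      = real ((CARD('n) - 1) choose (k - 1)) * (- N / 2 * ?\<Phi>1\<^sup>2) ^ (k - 1)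
        * (real CARD('n) / real k * (- N / 2 * ?\<Phi>1\<^sup>2) + ?\<Phi> * ?\<Phi>2 * N)"
    using sigma_k_scalar_plus_rank_one[OF assms(2,3), of "- N / 2 * ?\<Phi>1\<^sup>2" u \<alpha>] by simp
  also have "real CARD('n) / real k * (- N / 2 * ?\<Phi>1\<^sup>2) + ?\<Phi> * ?\<Phi>2 * N
      = N * (?\<Phi> * ?\<Phi>2 - real CARD('n) / (2 * real k) * ?\<Phi>1\<^sup>2)"
    by (simp add: algebra_simps)
  also have "(- N / 2 * ?\<Phi>1\<^sup>2) ^ (k - 1) = (- N / 2) ^ (k - 1) * ?\<Phi>1 ^ (2 * (k - 1))"
    unfolding power_mult_distrib power_mult ..
  finally show ?thesis by (simp only: mult_ac)
qed

lemma hessian: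
  assumes f: "\<And>x. f x = F (xi \<alpha> x)"
    and F1: "\<And>t. (F has_real_derivative F1 t) (at t)"
    and F2: "\<And>t. (F1 has_real_derivative F2 t) (at t)"
  shows "hessian g f x $ i $ j = (F2 (xi \<alpha> x) + 2 * v (xi \<alpha> x) * F1 (xi \<alpha> x)) * (\<alpha> $ i * \<alpha> $ j)
     - N * v (xi \<alpha> x) * F1 (xi \<alpha> x) * (\<epsilon> i * kronecker i j)"
proof -
  let ?t = "xi \<alpha> x"
  have "f = (\<lambda>y. F (xi \<alpha> y))" using f by auto
  then have P1: "partial j f = (\<lambda>x. F1 (xi \<alpha> x) * \<alpha> $ j)" for j
    using partial_along_xi[OF F1] by auto
  have "((\<lambda>t. F1 t * \<alpha> $ j) has_real_derivative F2 t * \<alpha> $ j) (at t)" for t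
    by (auto intro!: derivative_eq_intros F2)
  then have P2: "partial i (partial j f) x = F2 ?t * \<alpha> $ j * \<alpha> $ i"
    unfolding P1 by (rule partial_along_xi)
  have "(\<Sum>m\<in>UNIV. christoffel g m i j x * partial m f x)
      = - v ?t * F1 ?t * (\<Sum>m\<in>UNIV. \<Gamma> m i j * \<alpha> $ m)"
    unfolding christoffel P1 sum_distrib_left by (intro sum.cong) auto
  then show ?thesis
    unfolding \<Gamma>_contract_upper by (simp add: hessian_def P2 algebra_simps)
qed

end

section \<open>Rigidity of invariant steady solitons\<close>

context conformal_profile
begin

text \<open>The two components of the soliton equation give \<open>F' \<Phi>\<^sup>2 = const\<close> and, after eliminating \<open>F'\<close>, the
  profile equation; then \<open>liouville\<close> applies, because \<open>\<Phi>\<close> is defined on the whole line.\<close>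

lemma steady_soliton_trivial:
  assumes dim: "2 \<le> CARD('n)" and k: "1 \<le> k" "k \<le> CARD('n)" "CARD('n) \<noteq> 2 * k"
    and N: "N \<noteq> 0"
    and soliton: "steady_conformal_soliton k \<epsilon> \<phi> f"
    and f: "\<And>x. f x = F (xi \<alpha> x)"
    and F1: "\<And>t. (F has_real_derivative F1 t) (at t)"
    and F2: "\<And>t. (F1 has_real_derivative F2 t) (at t)"
  shows "\<Phi>1 t = 0" "F2 t = 0"
proof -
  define a where "a = real CARD('n) / (2 * real k)"
  define B where "B = real ((CARD('n) - 1) choose (k - 1)) * (- N / 2) ^ (k - 1)"
  define E where "E t = \<Phi>1 t ^ (2 * (k - 1)) * (\<Phi> t * \<Phi>2 t - a * (\<Phi>1 t)\<^sup>2)" for t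
  have \<alpha>: "\<alpha> \<noteq> 0" using N by (auto simp: N_def)
  have B: "B \<noteq> 0" using N k by (simp add: B_def)
  have "F2 t + 2 * v t * F1 t = 0 \<and> 2 * (real CARD('n) - 1) * (B * N * E t) / (\<Phi> t)\<^sup>2 + N * v t * F1 t = 0" for t
  proof -
    define x where "x = t *\<^sub>R ((1 / (\<alpha> \<bullet> \<alpha>)) *\<^sub>R \<alpha>)"
    have x: "xi \<alpha> x = t" unfolding x_def by (rule xi_surj[OF \<alpha>])
    have "hessian g f x
        = (2 * (real CARD('n) - 1) * sigma_k k (matrix_inv (g x) ** conformal_schouten \<epsilon> \<phi> x)) *\<^sub>R g x"
      using soliton by (simp add: steady_conformal_soliton_def gradient_k_Yamabe_soliton_def)
    also have "\<dots> = (2 * (real CARD('n) - 1) * (B * N * E t)) *\<^sub>R g x"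
      unfolding sigma_k_soliton[OF dim k(1,2)] x B_def E_def a_def ..
    finally have "hessian g f x $ i $ j = 2 * (real CARD('n) - 1) * (B * N * E t) * g x $ i $ j" for i j
      by simp
    then have eq: "(F2 t + 2 * v t * F1 t) * (\<alpha> $ i * \<alpha> $ j)
        = (2 * (real CARD('n) - 1) * (B * N * E t) / (\<Phi> t)\<^sup>2 + N * v t * F1 t) * (\<epsilon> i * kronecker i j)" for i j
      unfolding hessian[OF f F1 F2] metric_entry x diff_eq_eq distrib_right by simp
    have "\<epsilon> i \<noteq> 0" for i using \<epsilon>_sq[of i] by auto
    from rank_one_eq_diagonal_imp_zero[OF dim \<alpha> this eq] show ?thesis by blast
  qed
  then have F_eq: "F2 t + 2 * v t * F1 t = 0"
    and \<Phi>_eq: "2 * (real CARD('n) - 1) * (B * N * E t) / (\<Phi> t)\<^sup>2 + N * v t * F1 t = 0" for t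
    by blast+
  have "((\<lambda>t. F1 t * (\<Phi> t)\<^sup>2) has_real_derivative 0) (at t)" for t
  proof -
    have "F2 t * (\<Phi> t)\<^sup>2 + 2 * \<Phi> t * \<Phi>1 t * F1 t = (F2 t + 2 * v t * F1 t) * (\<Phi> t)\<^sup>2"
      using \<Phi>_pos[of t] by (simp add: v_def field_simps power2_eq_square)
    then have "F2 t * (\<Phi> t)\<^sup>2 + 2 * \<Phi> t * \<Phi>1 t * F1 t = 0"
      unfolding F_eq by simp
    then show ?thesis
      by (auto intro!: derivative_eq_intros F2 \<Phi>_D1 simp: algebra_simps)
  qed
  then have c: "F1 t * (\<Phi> t)\<^sup>2 = F1 0 * (\<Phi> 0)\<^sup>2" for t
    by (intro DERIV_isconst_all) auto
  define K where "K = - (F1 0 * (\<Phi> 0)\<^sup>2) / (2 * (real CARD('n) - 1) * B)"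
  interpret profile_ode \<Phi> \<Phi>1 \<Phi>2 "k - 1" a K
  proof
    fix t
    define q where "q = 2 * (real CARD('n) - 1) * B"
    have q: "q \<noteq> 0" using B dim by (simp add: q_def)
    have "2 * (real CARD('n) - 1) * (B * N * E t) / (\<Phi> t)\<^sup>2 = N * (q * E t) / (\<Phi> t)\<^sup>2"
      by (simp add: q_def mult_ac)
    then have "N * (q * E t) / (\<Phi> t)\<^sup>2 = - (N * v t * F1 t)"
      using \<Phi>_eq[of t] by linarith
    then have "N * (q * E t) = - (N * v t * F1 t) * (\<Phi> t)\<^sup>2"
      using \<Phi>_pos[of t] by (simp add: divide_eq_eq)
    also have "\<dots> = N * (- (F1 t * (\<Phi> t)\<^sup>2) * v t)"
      by (simp add: mult_ac)
    finally have "q * E t = - (F1 t * (\<Phi> t)\<^sup>2) * v t"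
      using N by (simp only: mult_cancel_left) simp
    also have "\<dots> = q * (K * v t)"
      unfolding c[of t] K_def q_def[symmetric] using q by simp
    finally have "E t = K * \<Phi>1 t / \<Phi> t"
      using q by (simp only: mult_cancel_left) (simp add: v_def)
    then show "\<Phi>1 t ^ (2 * (k - 1)) * (\<Phi> t * \<Phi>2 t - a * (\<Phi>1 t)\<^sup>2) = K * \<Phi>1 t / \<Phi> t"
      unfolding E_def .
    show "0 < a" using dim k(1) by (simp add: a_def)
  qed (rule \<Phi>_pos \<Phi>_D1 \<Phi>_D2)+
  have "a \<noteq> 1"
  proof
    assume "a = 1"
    then have "real CARD('n) = real (2 * k)" using k by (simp add: a_def)
    then show False using k(3) by (simp only: of_nat_eq_iff)
  qed
  moreover have "1 < a" if "k - 1 = 0"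
    using that k dim by (cases "k = 1") (auto simp: a_def)
  ultimately show "\<Phi>1 t = 0" by (rule liouville)
  then show "F2 t = 0" using F_eq[of t] by (simp add: v_def)
qed

end

theorem theorem1p4:
  fixes \<epsilon> :: "'n::finite \<Rightarrow> real"
    and \<phi> f :: "real ^ 'n \<Rightarrow> real"
    and \<alpha> :: "real ^ 'n"
    and k :: nat
  assumes "2 \<le> CARD('n)"
    and "1 \<le> k" and "k \<le> CARD('n)"
    and "CARD('n) \<noteq> 2 * k"
    and "\<forall>i. \<epsilon> i = 1 \<or> \<epsilon> i = - 1"
    and "smooth \<phi>" and "\<forall>x. 0 < \<phi> x"
    and "steady_conformal_soliton k \<epsilon> \<phi> f"
    and "(\<Sum>i\<in>UNIV. \<epsilon> i * (\<alpha> $ i)\<^sup>2) \<noteq> 0"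
  shows "(translation_invariant \<alpha> \<phi> \<and> translation_invariant \<alpha> f) \<longleftrightarrow>
    (\<exists>\<Phi> F. (\<forall>x. \<phi> x = \<Phi> (xi \<alpha> x)) \<and> (\<forall>x. f x = F (xi \<alpha> x)) \<and>
           (case_a \<Phi> F \<or> case_b CARD('n) k \<Phi> F))"
proof
  assume "translation_invariant \<alpha> \<phi> \<and> translation_invariant \<alpha> f"
  then obtain \<Phi> F where \<Phi>: "\<And>x. \<phi> x = \<Phi> (xi \<alpha> x)" and F: "\<And>x. f x = F (xi \<alpha> x)"
    by (auto simp: translation_invariant_def)
  have \<alpha>: "\<alpha> \<noteq> 0" using assms(9) by auto
  have "\<phi> = (\<lambda>y. \<Phi> (xi \<alpha> y))" "f = (\<lambda>y. F (xi \<alpha> y))"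
    using \<Phi> F by auto
  moreover have "smooth f"
    using assms(8) by (simp add: steady_conformal_soliton_def gradient_k_Yamabe_soliton_def)
  ultimately have "smooth (\<lambda>y. \<Phi> (xi \<alpha> y))" "smooth (\<lambda>y. F (xi \<alpha> y))"
    using assms(6) by simp_all
  note \<Phi>_derivs = smooth_profile[OF \<alpha> this(1)] and F_derivs = smooth_profile[OF \<alpha> this(2)]
  have \<Phi>_pos: "0 < \<Phi> t" for t
    using assms(7)[rule_format, of "t *\<^sub>R ((1 / (\<alpha> \<bullet> \<alpha>)) *\<^sub>R \<alpha>)"]
    unfolding \<Phi> xi_surj[OF \<alpha>] .
  interpret conformal_profile \<epsilon> \<alpha> \<phi> \<Phi> "deriv \<Phi>" "deriv (deriv \<Phi>)"
  proof
    show "\<epsilon> i * \<epsilon> i = 1" for i using assms(5)[rule_format, of i] by auto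
  qed (rule \<Phi> \<Phi>_pos \<Phi>_derivs)+
  have "N \<noteq> 0" using assms(9) by (simp add: N_def)
  note trivial = steady_soliton_trivial[OF assms(1-4) this assms(8) F F_derivs]
  have \<Phi>_const: "\<Phi> t = \<Phi> 0" for t
    using \<Phi>_derivs(1) unfolding trivial(1) by (intro DERIV_isconst_all) auto
  have F'_const: "deriv F t = deriv F 0" for t
    using F_derivs(2) unfolding trivial(2) by (intro DERIV_isconst_all) auto
  have F_affine: "F t = deriv F 0 * t + F 0" for t
  proof -
    have "((\<lambda>t. F t - deriv F 0 * t) has_real_derivative 0) (at t)" for t
      using F_derivs(1)[of t] F'_const[of t] by (auto intro!: derivative_eq_intros)
    then have "F t - deriv F 0 * t = F 0 - deriv F 0 * 0"
      by (intro DERIV_isconst_all[of "\<lambda>t. F t - deriv F 0 * t"]) auto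
    then show ?thesis by linarith
  qed
  have "case_a \<Phi> F"
    unfolding case_a_def
  proof (intro conjI allI exI)
    show "deriv \<Phi> t = 0" for t by (rule trivial(1))
    show "0 < \<Phi> 0" by (rule \<Phi>_pos)
    show "\<Phi> t = \<Phi> 0" for t by (rule \<Phi>_const)
    show "F t = deriv F 0 * t + F 0" for t by (rule F_affine)
  qed
  with \<Phi> F show "\<exists>\<Phi> F. (\<forall>x. \<phi> x = \<Phi> (xi \<alpha> x)) \<and> (\<forall>x. f x = F (xi \<alpha> x)) \<and>
      (case_a \<Phi> F \<or> case_b CARD('n) k \<Phi> F)"
    by blast
next
  assume "\<exists>\<Phi> F. (\<forall>x. \<phi> x = \<Phi> (xi \<alpha> x)) \<and> (\<forall>x. f x = F (xi \<alpha> x)) \<and>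
      (case_a \<Phi> F \<or> case_b CARD('n) k \<Phi> F)"
  then show "translation_invariant \<alpha> \<phi> \<and> translation_invariant \<alpha> f"
    by (auto simp: translation_invariant_def)
qed

end
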